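(* For every iteration command $S$ there is a closed first-order formula $\mathrm{Fail}(S)$ such that for every host graph $G$, $G\models \mathrm{Fail}(S)$ if and only if $\mathrm{fail}\in[\![S]\!]G$.
   Context: GP 2 host graphs have finite node/edge sets, source/target maps, node and edge labels consisting of a list (finite sequence of integers and strings) and a mark, and a rootedness function on nodes. GP 2 programs are built from rule set calls $\{r_1,\dots,r_n\}$ of conditional rule schemata (with $\mathtt{skip}$ the rule with empty left and right graph and $\mathtt{fail}$ the empty rule set), $\mathtt{break}$, $P\ \mathtt{or}\ Q$, $P;Q$, $\mathtt{if}\ C\ \mathtt{then}\ P\ \mathtt{else}\ Q$, $\mathtt{try}\ C\ \mathtt{then}\ P\ \mathtt{else}\ Q$ and the loop $P!$ (execute $P$ as long as possible: repeat $P$ until an execution of $P$ fails, in which case the loop returns the current graph, or $\mathtt{break}$ is executed, in which case the loop terminates with the current graph). $[\![P]\!]G$ is the set of outcomes (host graphs, $\mathrm{fail}$, or $\bot$ for divergence) of executing $P$ on $G$; a rule set call fails iff no rule in it is applicable; $\mathtt{break}$ outside a loop behaves as $\mathtt{skip}$. A program is loop-free if it contains no $!$. Non-failing commands are defined inductively: $\mathtt{break}$ and $\mathtt{skip}$; every call of a rule schema with empty left-hand graph; every rule set call $\{r_1,\dots,r_n\}$ with $n\ge1$ where every $r_i$ has empty left-hand graph; every command $P!$; and $P;Q$, $\mathtt{if}\ C\ \mathtt{then}\ P\ \mathtt{else}\ Q$, $\mathtt{try}\ C\ \mathtt{then}\ P\ \mathtt{else}\ Q$ whenever $P$ and $Q$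 are non-failing. Iteration commands are defined inductively: every loop-free program; every non-failing command; and every $C;P$ with $C$ loop-free and $P$ an iteration command. First-order formulas over host graphs are built from $\mathsf{true},\mathsf{false}$, predicates $\mathsf{int},\mathsf{char},\mathsf{string},\mathsf{atom},\mathsf{root}$, comparisons of terms, Boolean connectives and existential quantifiers over nodes, edges and lists; terms use variables, constants, $\mathsf{s},\mathsf{t},\mathsf{l_V},\mathsf{l_E},\mathsf{m_V},\mathsf{m_E},\mathsf{indeg},\mathsf{outdeg},\mathsf{length}$, integer arithmetic and concatenation. $G\models c$ is standard truth of a closed formula in $G$.
   Formalization: A rule set call whose rules all have empty left-hand graph counts as non-failing only if at least one of its rules has a true (or no) condition; with an always-false condition such as 1 = 2 the call always fails and the claim is false, e.g. for P!; r. *)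

theory Defs
  imports Main
begin

section \<open>Graphs\<close>

datatype hatom = HInt int | HStr string

type_synonym hlist = "hatom list"

datatype nmark = NNone | NRed | NGreen | NBlue | NGrey
datatype emark = ENone | ERed | EGreen | EBlue | EDashed

text \<open>The labelling functions and the end-point functions of a graph are only
  meaningful on its nodes and edges.\<close>

record ('l, 'nm, 'em) graph =
  nodes :: "nat set"
  edges :: "nat set"
  src :: "nat \<Rightarrow> nat"
  tgt :: "nat \<Rightarrow> nat"
  nlabel :: "nat \<Rightarrow> 'l"
  elabel :: "nat \<Rightarrow> 'l"
  nmark :: "nat \<Rightarrow> 'nm"
  emark :: "nat \<Rightarrow> 'em"
  rooted :: "nat \<Rightarrow> bool"

type_synonym host = "(hlist, nmark, emark) graph"

definition wf_graph :: "('l, 'nm, 'em) graph \<Rightarrow> bool" where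
  "wf_graph G \<longleftrightarrow> finite (nodes G) \<and> finite (edges G) \<and>
     src G ` edges G \<subseteq> nodes G \<and> tgt G ` edges G \<subseteq> nodes G"

abbreviation host_graph :: "host \<Rightarrow> bool" where
  "host_graph G \<equiv> wf_graph G"

definition indeg :: "('l, 'nm, 'em) graph \<Rightarrow> nat \<Rightarrow> nat" where
  "indeg G v = card {e \<in> edges G. tgt G e = v}"

definition outdeg :: "('l, 'nm, 'em) graph \<Rightarrow> nat \<Rightarrow> nat" where
  "outdeg G v = card {e \<in> edges G. src G e = v}"


section \<open>Variables and expressions\<close>

datatype var = IntVar nat | CharVar nat | StrVar nat | AtomVar nat | ListVar nat

text \<open>Values are always lists; atoms are identified with one-element lists and
  characters with one-element strings.\<close>

definition is_int :: "hlist \<Rightarrow> bool" where "is_int xs \<longleftrightarrow> (\<exists>i. xs = [HInt i])"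
definition is_char :: "hlist \<Rightarrow> bool" where "is_char xs \<longleftrightarrow> (\<exists>c. xs = [HStr [c]])"
definition is_string :: "hlist \<Rightarrow> bool" where "is_string xs \<longleftrightarrow> (\<exists>s. xs = [HStr s])"
definition is_atom :: "hlist \<Rightarrow> bool" where "is_atom xs \<longleftrightarrow> (\<exists>a. xs = [a])"

fun vdom :: "var \<Rightarrow> hlist set" where
  "vdom (IntVar _) = Collect is_int"
| "vdom (CharVar _) = Collect is_char"
| "vdom (StrVar _) = Collect is_string"
| "vdom (AtomVar _) = Collect is_atom"
| "vdom (ListVar _) = UNIV"

type_synonym assignment = "var \<Rightarrow> hlist"

definition well_typed :: "assignment \<Rightarrow> bool" where
  "well_typed \<alpha> \<longleftrightarrow> (\<forall>x. \<alpha> x \<in> vdom x)"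

text \<open>The default cases of these two functions are never reached under a
  well-typed assignment.\<close>

fun the_int :: "hlist \<Rightarrow> int" where
  "the_int [HInt i] = i"
| "the_int _ = 0"

fun the_str :: "hlist \<Rightarrow> string" where
  "the_str [HStr s] = s"
| "the_str _ = []"

text \<open>The length of a list variable is its number of atoms. For the other types, a
  string counts its characters.\<close>

fun vlength :: "var \<Rightarrow> hlist \<Rightarrow> nat" where
  "vlength (ListVar _) xs = length xs"
| "vlength _ [HStr s] = length s"
| "vlength _ xs = length xs"

text \<open>The type parameter stands for the node expressions in degree operators:
  node identifiers in rule schemata, node terms in formulas.\<close>

datatype 'n iexp =
    Num int
  | IVar nat
  | Add "'n iexp" "'n iexp"
  | Sub "'n iexp" "'n iexp"
  | Mul "'n iexp" "'n iexp"
  | Div "'n iexp" "'n iexp"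
  | Indeg 'n
  | Outdeg 'n
  | Length var

datatype sexp = SConst string | CVar nat | SVar nat | SCat sexp sexp

datatype 'n aexp = AInt "'n iexp" | AStr sexp | AVar nat

datatype 'n lexp = LEmpty | LAtom "'n aexp" | LVar nat | LConc "'n lexp" "'n lexp"

text \<open>Division is the total integer division of the library; in particular
  division by zero yields zero.\<close>

fun ieval :: "('n \<Rightarrow> nat) \<Rightarrow> ('n \<Rightarrow> nat) \<Rightarrow> assignment \<Rightarrow> 'n iexp \<Rightarrow> int" where
  "ieval ind outd \<alpha> (Num i) = i"
| "ieval ind outd \<alpha> (IVar x) = the_int (\<alpha> (IntVar x))"
| "ieval ind outd \<alpha> (Add a b) = ieval ind outd \<alpha> a + ieval ind outd \<alpha> b"
| "ieval ind outd \<alpha> (Sub a b) = ieval ind outd \<alpha> a - ieval ind outd \<alpha> b"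
| "ieval ind outd \<alpha> (Mul a b) = ieval ind outd \<alpha> a * ieval ind outd \<alpha> b"
| "ieval ind outd \<alpha> (Div a b) = ieval ind outd \<alpha> a div ieval ind outd \<alpha> b"
| "ieval ind outd \<alpha> (Indeg n) = int (ind n)"
| "ieval ind outd \<alpha> (Outdeg n) = int (outd n)"
| "ieval ind outd \<alpha> (Length x) = int (vlength x (\<alpha> x))"

fun seval :: "assignment \<Rightarrow> sexp \<Rightarrow> string" where
  "seval \<alpha> (SConst s) = s"
| "seval \<alpha> (CVar x) = the_str (\<alpha> (CharVar x))"
| "seval \<alpha> (SVar x) = the_str (\<alpha> (StrVar x))"
| "seval \<alpha> (SCat a b) = seval \<alpha> a @ seval \<alpha> b"

fun aeval :: "('n \<Rightarrow> nat) \<Rightarrow> ('n \<Rightarrow> nat) \<Rightarrow> assignment \<Rightarrow> 'n aexp \<Rightarrow> hlist" where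
  "aeval ind outd \<alpha> (AInt a) = [HInt (ieval ind outd \<alpha> a)]"
| "aeval ind outd \<alpha> (AStr s) = [HStr (seval \<alpha> s)]"
| "aeval ind outd \<alpha> (AVar x) = \<alpha> (AtomVar x)"

fun leval :: "('n \<Rightarrow> nat) \<Rightarrow> ('n \<Rightarrow> nat) \<Rightarrow> assignment \<Rightarrow> 'n lexp \<Rightarrow> hlist" where
  "leval ind outd \<alpha> LEmpty = []"
| "leval ind outd \<alpha> (LAtom a) = aeval ind outd \<alpha> a"
| "leval ind outd \<alpha> (LVar x) = \<alpha> (ListVar x)"
| "leval ind outd \<alpha> (LConc a b) = leval ind outd \<alpha> a @ leval ind outd \<alpha> b"

fun ivars :: "'n iexp \<Rightarrow> var set" where
  "ivars (Num _) = {}"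
| "ivars (IVar x) = {IntVar x}"
| "ivars (Add a b) = ivars a \<union> ivars b"
| "ivars (Sub a b) = ivars a \<union> ivars b"
| "ivars (Mul a b) = ivars a \<union> ivars b"
| "ivars (Div a b) = ivars a \<union> ivars b"
| "ivars (Indeg _) = {}"
| "ivars (Outdeg _) = {}"
| "ivars (Length x) = {x}"

fun svars :: "sexp \<Rightarrow> var set" where
  "svars (SConst _) = {}"
| "svars (CVar x) = {CharVar x}"
| "svars (SVar x) = {StrVar x}"
| "svars (SCat a b) = svars a \<union> svars b"

fun avars :: "'n aexp \<Rightarrow> var set" where
  "avars (AInt a) = ivars a"
| "avars (AStr s) = svars s"
| "avars (AVar x) = {AtomVar x}"

fun lvars :: "'n lexp \<Rightarrow> var set" where
  "lvars LEmpty = {}"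
| "lvars (LAtom a) = avars a"
| "lvars (LVar x) = {ListVar x}"
| "lvars (LConc a b) = lvars a \<union> lvars b"

text \<open>Simple expressions, the only ones allowed in left-hand graphs: no arithmetic,
  degree or length operators, at most one occurrence of a list variable, and at most
  one occurrence of a string variable in each string expression.\<close>

fun svar_count :: "sexp \<Rightarrow> nat" where
  "svar_count (SConst _) = 0"
| "svar_count (CVar _) = 0"
| "svar_count (SVar _) = 1"
| "svar_count (SCat a b) = svar_count a + svar_count b"

fun lvar_count :: "'n lexp \<Rightarrow> nat" where
  "lvar_count LEmpty = 0"
| "lvar_count (LAtom _) = 0"
| "lvar_count (LVar _) = 1"
| "lvar_count (LConc a b) = lvar_count a + lvar_count b"

fun simple_iexp :: "'n iexp \<Rightarrow> bool" where
  "simple_iexp (Num _) = True"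
| "simple_iexp (IVar _) = True"
| "simple_iexp _ = False"

fun simple_atoms :: "'n lexp \<Rightarrow> bool" where
  "simple_atoms LEmpty = True"
| "simple_atoms (LAtom (AInt a)) = simple_iexp a"
| "simple_atoms (LAtom (AStr s)) = (svar_count s \<le> 1)"
| "simple_atoms (LAtom (AVar _)) = True"
| "simple_atoms (LVar _) = True"
| "simple_atoms (LConc a b) = (simple_atoms a \<and> simple_atoms b)"

definition simple :: "'n lexp \<Rightarrow> bool" where
  "simple l \<longleftrightarrow> simple_atoms l \<and> lvar_count l \<le> 1"

datatype rel = Less | LessEq | Greater | GreaterEq

fun rel_holds :: "rel \<Rightarrow> int \<Rightarrow> int \<Rightarrow> bool" where
  "rel_holds Less i j = (i < j)"
| "rel_holds LessEq i j = (i \<le> j)"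
| "rel_holds Greater i j = (i > j)"
| "rel_holds GreaterEq i j = (i \<ge> j)"


section \<open>Conditional rule schemata\<close>

text \<open>The mark \<open>any\<close> of rule schemata stands for an arbitrary mark other than \<open>none\<close>.\<close>

datatype 'm rmark = Mark 'm | AnyMark

fun mark_matches :: "'m \<Rightarrow> 'm rmark \<Rightarrow> 'm \<Rightarrow> bool" where
  "mark_matches none (Mark m) m' = (m' = m)"
| "mark_matches none AnyMark m' = (m' \<noteq> none)"

type_synonym rgraph = "(nat lexp, nmark rmark, emark rmark) graph"

text \<open>In the edge predicate, the list and the mark are optional.\<close>

datatype rcond =
    RInt var
  | RChar var
  | RString var
  | RAtom var
  | REq "nat lexp" "nat lexp"
  | RNeq "nat lexp" "nat lexp"
  | RRel rel "nat iexp" "nat iexp"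
  | REdge nat nat "nat lexp option" "emark rmark option"
  | RNot rcond
  | RAnd rcond rcond
  | ROr rcond rcond

fun rcond_vars :: "rcond \<Rightarrow> var set" where
  "rcond_vars (RInt x) = {x}"
| "rcond_vars (RChar x) = {x}"
| "rcond_vars (RString x) = {x}"
| "rcond_vars (RAtom x) = {x}"
| "rcond_vars (REq a b) = lvars a \<union> lvars b"
| "rcond_vars (RNeq a b) = lvars a \<union> lvars b"
| "rcond_vars (RRel _ a b) = ivars a \<union> ivars b"
| "rcond_vars (REdge _ _ l _) = (case l of None \<Rightarrow> {} | Some a \<Rightarrow> lvars a)"
| "rcond_vars (RNot c) = rcond_vars c"
| "rcond_vars (RAnd c d) = rcond_vars c \<union> rcond_vars d"
| "rcond_vars (ROr c d) = rcond_vars c \<union> rcond_vars d"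

fun rcond_nodes :: "rcond \<Rightarrow> nat set" where
  "rcond_nodes (RInt _) = {}"
| "rcond_nodes (RChar _) = {}"
| "rcond_nodes (RString _) = {}"
| "rcond_nodes (RAtom _) = {}"
| "rcond_nodes (REq a b) = set_lexp a \<union> set_lexp b"
| "rcond_nodes (RNeq a b) = set_lexp a \<union> set_lexp b"
| "rcond_nodes (RRel _ a b) = set_iexp a \<union> set_iexp b"
| "rcond_nodes (REdge u v l _) = {u, v} \<union> (case l of None \<Rightarrow> {} | Some a \<Rightarrow> set_lexp a)"
| "rcond_nodes (RNot c) = rcond_nodes c"
| "rcond_nodes (RAnd c d) = rcond_nodes c \<union> rcond_nodes d"
| "rcond_nodes (ROr c d) = rcond_nodes c \<union> rcond_nodes d"

text \<open>Expressions of a rule schema are evaluated in the host graph to which the rule is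
  applied: \<open>g\<close> is the node component of the match.\<close>

abbreviation rieval :: "host \<Rightarrow> (nat \<Rightarrow> nat) \<Rightarrow> assignment \<Rightarrow> nat iexp \<Rightarrow> int" where
  "rieval G g \<equiv> ieval (\<lambda>v. indeg G (g v)) (\<lambda>v. outdeg G (g v))"

abbreviation rleval :: "host \<Rightarrow> (nat \<Rightarrow> nat) \<Rightarrow> assignment \<Rightarrow> nat lexp \<Rightarrow> hlist" where
  "rleval G g \<equiv> leval (\<lambda>v. indeg G (g v)) (\<lambda>v. outdeg G (g v))"

fun rcond_holds :: "host \<Rightarrow> (nat \<Rightarrow> nat) \<Rightarrow> assignment \<Rightarrow> rcond \<Rightarrow> bool" where
  "rcond_holds G g \<alpha> (RInt x) = is_int (\<alpha> x)"
| "rcond_holds G g \<alpha> (RChar x) = is_char (\<alpha> x)"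
| "rcond_holds G g \<alpha> (RString x) = is_string (\<alpha> x)"
| "rcond_holds G g \<alpha> (RAtom x) = is_atom (\<alpha> x)"
| "rcond_holds G g \<alpha> (REq a b) = (rleval G g \<alpha> a = rleval G g \<alpha> b)"
| "rcond_holds G g \<alpha> (RNeq a b) = (rleval G g \<alpha> a \<noteq> rleval G g \<alpha> b)"
| "rcond_holds G g \<alpha> (RRel r a b) = rel_holds r (rieval G g \<alpha> a) (rieval G g \<alpha> b)"
| "rcond_holds G g \<alpha> (REdge u v l m) =
     (\<exists>e \<in> edges G. src G e = g u \<and> tgt G e = g v \<and>
        (case l of None \<Rightarrow> True | Some a \<Rightarrow> elabel G e = rleval G g \<alpha> a) \<and>
        (case m of None \<Rightarrow> True | Some k \<Rightarrow> mark_matches ENone k (emark G e)))"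
| "rcond_holds G g \<alpha> (RNot c) = (\<not> rcond_holds G g \<alpha> c)"
| "rcond_holds G g \<alpha> (RAnd c d) = (rcond_holds G g \<alpha> c \<and> rcond_holds G g \<alpha> d)"
| "rcond_holds G g \<alpha> (ROr c d) = (rcond_holds G g \<alpha> c \<or> rcond_holds G g \<alpha> d)"

text \<open>The interface of a rule schema consists of unlabelled nodes only, so it is given
  by a set of node identifiers shared by both graphs.\<close>

record rule =
  lhs :: rgraph
  rhs :: rgraph
  iface :: "nat set"
  rcond :: "rcond option"

definition cond_holds :: "rule \<Rightarrow> host \<Rightarrow> (nat \<Rightarrow> nat) \<Rightarrow> assignment \<Rightarrow> bool" where
  "cond_holds r G g \<alpha> \<longleftrightarrow> (case rcond r of None \<Rightarrow> True | Some c \<Rightarrow> rcond_holds G g \<alpha> c)"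

definition rgraph_labels :: "rgraph \<Rightarrow> nat lexp set" where
  "rgraph_labels L = nlabel L ` nodes L \<union> elabel L ` edges L"

definition rgraph_vars :: "rgraph \<Rightarrow> var set" where
  "rgraph_vars L = (\<Union>l \<in> rgraph_labels L. lvars l)"

text \<open>An item of the right-hand graph may carry the mark \<open>any\<close> only if the item with the
  same identifier in the left-hand graph does; it then keeps the matched item's mark.\<close>

definition wf_rule :: "rule \<Rightarrow> bool" where
  "wf_rule r \<longleftrightarrow>
     wf_graph (lhs r) \<and> wf_graph (rhs r) \<and>
     iface r \<subseteq> nodes (lhs r) \<inter> nodes (rhs r) \<and>
     (\<forall>l \<in> rgraph_labels (lhs r). simple l) \<and>
     rgraph_vars (rhs r) \<subseteq> rgraph_vars (lhs r) \<and>
     (\<forall>l \<in> rgraph_labels (rhs r). set_lexp l \<subseteq> nodes (lhs r)) \<and>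
     (\<forall>c. rcond r = Some c \<longrightarrow>
        rcond_vars c \<subseteq> rgraph_vars (lhs r) \<and> rcond_nodes c \<subseteq> nodes (lhs r)) \<and>
     (\<forall>v \<in> nodes (rhs r). nmark (rhs r) v = AnyMark \<longrightarrow>
        v \<in> iface r \<and> nmark (lhs r) v = AnyMark) \<and>
     (\<forall>e \<in> edges (rhs r). emark (rhs r) e = AnyMark \<longrightarrow>
        e \<in> edges (lhs r) \<and> emark (lhs r) e = AnyMark)"

text \<open>A match is an injective morphism from the instantiated left-hand graph that
  satisfies the dangling condition and the rule schema's condition.\<close>

definition is_match ::
    "rule \<Rightarrow> host \<Rightarrow> (nat \<Rightarrow> nat) \<Rightarrow> (nat \<Rightarrow> nat) \<Rightarrow> assignment \<Rightarrow> bool" where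
  "is_match r G gV gE \<alpha> \<longleftrightarrow> (let L = lhs r in
     well_typed \<alpha> \<and>
     inj_on gV (nodes L) \<and> gV ` nodes L \<subseteq> nodes G \<and>
     inj_on gE (edges L) \<and> gE ` edges L \<subseteq> edges G \<and>
     (\<forall>e \<in> edges L. src G (gE e) = gV (src L e) \<and> tgt G (gE e) = gV (tgt L e)) \<and>
     (\<forall>v \<in> nodes L. nlabel G (gV v) = rleval G gV \<alpha> (nlabel L v) \<and>
        mark_matches NNone (nmark L v) (nmark G (gV v)) \<and>
        rooted G (gV v) = rooted L v) \<and>
     (\<forall>e \<in> edges L. elabel G (gE e) = rleval G gV \<alpha> (elabel L e) \<and>
        mark_matches ENone (emark L e) (emark G (gE e))) \<and>
     (\<forall>e \<in> edges G - gE ` edges L.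
        src G e \<notin> gV ` (nodes L - iface r) \<and> tgt G e \<notin> gV ` (nodes L - iface r)) \<and>
     cond_holds r G gV \<alpha>)"

fun new_mark :: "'m \<Rightarrow> 'm rmark \<Rightarrow> 'm" where
  "new_mark old (Mark m) = m"
| "new_mark old AnyMark = old"

text \<open>\<open>H\<close> results from \<open>G\<close> by deleting the image of the left-hand graph except for the
  interface nodes, and adding the right-hand graph via the comatch \<open>(hV, hE)\<close>, which
  assigns arbitrary fresh identifiers to the new nodes and edges.\<close>

definition is_result ::
    "rule \<Rightarrow> host \<Rightarrow> (nat \<Rightarrow> nat) \<Rightarrow> (nat \<Rightarrow> nat) \<Rightarrow> assignment \<Rightarrow>
     (nat \<Rightarrow> nat) \<Rightarrow> (nat \<Rightarrow> nat) \<Rightarrow> host \<Rightarrow> bool" where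
  "is_result r G gV gE \<alpha> hV hE H \<longleftrightarrow> (let L = lhs r; R = rhs r in
     inj_on hV (nodes R) \<and> (\<forall>v \<in> iface r. hV v = gV v) \<and>
     hV ` (nodes R - iface r) \<inter> nodes G = {} \<and>
     inj_on hE (edges R) \<and> hE ` edges R \<inter> edges G = {} \<and>
     nodes H = (nodes G - gV ` (nodes L - iface r)) \<union> hV ` nodes R \<and>
     edges H = (edges G - gE ` edges L) \<union> hE ` edges R \<and>
     (\<forall>v \<in> nodes G - gV ` nodes L.
        nlabel H v = nlabel G v \<and> nmark H v = nmark G v \<and> rooted H v = rooted G v) \<and>
     (\<forall>v \<in> nodes R.
        nlabel H (hV v) = rleval G gV \<alpha> (nlabel R v) \<and>
        nmark H (hV v) = new_mark (nmark G (gV v)) (nmark R v) \<and>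
        rooted H (hV v) = rooted R v) \<and>
     (\<forall>e \<in> edges G - gE ` edges L.
        src H e = src G e \<and> tgt H e = tgt G e \<and>
        elabel H e = elabel G e \<and> emark H e = emark G e) \<and>
     (\<forall>e \<in> edges R.
        src H (hE e) = hV (src R e) \<and> tgt H (hE e) = hV (tgt R e) \<and>
        elabel H (hE e) = rleval G gV \<alpha> (elabel R e) \<and>
        emark H (hE e) = new_mark (emark G (gE e)) (emark R e)))"

definition derives :: "host \<Rightarrow> rule \<Rightarrow> host \<Rightarrow> bool" where
  "derives G r H \<longleftrightarrow>
     (\<exists>gV gE \<alpha> hV hE. is_match r G gV gE \<alpha> \<and> is_result r G gV gE \<alpha> hV hE H)"


section \<open>Programs\<close>

datatype prog =
    Call "rule list"
  | Break
  | Or prog prog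
  | Seq prog prog
  | If prog prog prog
  | Try prog prog prog
  | Loop prog

definition empty_rgraph :: rgraph where
  "empty_rgraph = \<lparr>nodes = {}, edges = {}, src = id, tgt = id,
     nlabel = (\<lambda>_. LEmpty), elabel = (\<lambda>_. LEmpty),
     nmark = (\<lambda>_. Mark NNone), emark = (\<lambda>_. Mark ENone), rooted = (\<lambda>_. False)\<rparr>"

definition Skip :: prog where
  "Skip = Call [\<lparr>lhs = empty_rgraph, rhs = empty_rgraph, iface = {}, rcond = None\<rparr>]"

definition FailProg :: prog where
  "FailProg = Call []"

fun wf_prog :: "prog \<Rightarrow> bool" where
  "wf_prog (Call rs) = (\<forall>r \<in> set rs. wf_rule r)"
| "wf_prog Break = True"
| "wf_prog (Or P Q) = (wf_prog P \<and> wf_prog Q)"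
| "wf_prog (Seq P Q) = (wf_prog P \<and> wf_prog Q)"
| "wf_prog (If C P Q) = (wf_prog C \<and> wf_prog P \<and> wf_prog Q)"
| "wf_prog (Try C P Q) = (wf_prog C \<and> wf_prog P \<and> wf_prog Q)"
| "wf_prog (Loop P) = wf_prog P"

fun loop_free :: "prog \<Rightarrow> bool" where
  "loop_free (Call _) = True"
| "loop_free Break = True"
| "loop_free (Or P Q) = (loop_free P \<and> loop_free Q)"
| "loop_free (Seq P Q) = (loop_free P \<and> loop_free Q)"
| "loop_free (If C P Q) = (loop_free C \<and> loop_free P \<and> loop_free Q)"
| "loop_free (Try C P Q) = (loop_free C \<and> loop_free P \<and> loop_free Q)"
| "loop_free (Loop _) = False"

text \<open>The condition of a well-formed rule schema with empty left-hand graph contains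
  neither variables nor nodes, so it is constantly true or constantly false. If it is
  false (as in \<open>1 = 2\<close>), the rule is never applicable; hence a rule set call with empty
  left-hand graphs never fails precisely if not all of its rules have a false condition.
  For rules without conditions this just says that the call is nonempty. Without it a command such as \<open>P!; r\<close>, with \<open>r\<close> a rule of this kind
  whose condition is false, would fail exactly on the graphs on which the loop can
  terminate, and no first-order formula expresses that in general.\<close>

definition empty_lhs :: "rule \<Rightarrow> bool" where
  "empty_lhs r \<longleftrightarrow> nodes (lhs r) = {} \<and> edges (lhs r) = {}"

definition cond_true :: "rule \<Rightarrow> bool" where
  "cond_true r \<longleftrightarrow> (\<forall>G g \<alpha>. cond_holds r G g \<alpha>)"

inductive non_failing :: "prog \<Rightarrow> bool" where
  "non_failing Break"
| "non_failing Skip"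
| "\<lbrakk>rs \<noteq> []; \<forall>r \<in> set rs. empty_lhs r; \<exists>r \<in> set rs. cond_true r\<rbrakk> \<Longrightarrow> non_failing (Call rs)"
| "non_failing (Loop P)"
| "\<lbrakk>non_failing P; non_failing Q\<rbrakk> \<Longrightarrow> non_failing (Seq P Q)"
| "\<lbrakk>non_failing P; non_failing Q\<rbrakk> \<Longrightarrow> non_failing (If C P Q)"
| "\<lbrakk>non_failing P; non_failing Q\<rbrakk> \<Longrightarrow> non_failing (Try C P Q)"

inductive iteration_command :: "prog \<Rightarrow> bool" where
  "loop_free P \<Longrightarrow> iteration_command P"
| "non_failing P \<Longrightarrow> iteration_command P"
| "\<lbrakk>loop_free C; iteration_command P\<rbrakk> \<Longrightarrow> iteration_command (Seq C P)"


section \<open>Semantics of programs\<close>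

datatype config = Run prog host | Done host | Failed

lemma mono_tranclp [mono]:
  "(\<And>a b. x a b \<longrightarrow> y a b) \<Longrightarrow> x\<^sup>+\<^sup>+ a b \<longrightarrow> y\<^sup>+\<^sup>+ a b"
proof
  assume "\<And>a b. x a b \<longrightarrow> y a b" and "x\<^sup>+\<^sup>+ a b"
  from this(2,1) show "y\<^sup>+\<^sup>+ a b"
    by (induction rule: tranclp.induct) (auto intro: tranclp.trancl_into_trancl)
qed

text \<open>The flag tells whether execution takes place inside a loop body. Outside, \<open>break\<close>
  behaves as \<open>skip\<close>; inside, \<open>break\<close> discards the rest of the body, and the configuration
  consisting of \<open>break\<close> only is recognised by the loop. A \<open>break\<close> executed in the condition
  of a branching command inside a loop also terminates that loop; as usual, \<open>if\<close> discards
  and \<open>try\<close> keeps the changes made by the condition.\<close>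

inductive step :: "bool \<Rightarrow> config \<Rightarrow> config \<Rightarrow> bool" where
  call1: "\<lbrakk>r \<in> set rs; derives G r H\<rbrakk> \<Longrightarrow> step b (Run (Call rs) G) (Done H)"
| call2: "\<nexists>r H. r \<in> set rs \<and> derives G r H \<Longrightarrow> step b (Run (Call rs) G) Failed"
| break_outside: "step False (Run Break G) (Done G)"
| break_inside: "step True (Run (Seq Break P) G) (Run Break G)"
| or1: "step b (Run (Or P Q) G) (Run P G)"
| or2: "step b (Run (Or P Q) G) (Run Q G)"
| seq1: "step b (Run P G) (Run P' H) \<Longrightarrow> step b (Run (Seq P Q) G) (Run (Seq P' Q) H)"
| seq2: "step b (Run P G) (Done H) \<Longrightarrow> step b (Run (Seq P Q) G) (Run Q H)"
| seq3: "step b (Run P G) Failed \<Longrightarrow> step b (Run (Seq P Q) G) Failed"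
| if1: "(step b)\<^sup>+\<^sup>+ (Run C G) (Done H) \<Longrightarrow> step b (Run (If C P Q) G) (Run P G)"
| if2: "(step b)\<^sup>+\<^sup>+ (Run C G) Failed \<Longrightarrow> step b (Run (If C P Q) G) (Run Q G)"
| if3: "(step True)\<^sup>*\<^sup>* (Run C G) (Run Break H) \<Longrightarrow> step True (Run (If C P Q) G) (Run Break G)"
| try1: "(step b)\<^sup>+\<^sup>+ (Run C G) (Done H) \<Longrightarrow> step b (Run (Try C P Q) G) (Run P H)"
| try2: "(step b)\<^sup>+\<^sup>+ (Run C G) Failed \<Longrightarrow> step b (Run (Try C P Q) G) (Run Q G)"
| try3: "(step True)\<^sup>*\<^sup>* (Run C G) (Run Break H) \<Longrightarrow> step True (Run (Try C P Q) G) (Run Break H)"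
| loop1: "(step True)\<^sup>+\<^sup>+ (Run P G) (Done H) \<Longrightarrow> step b (Run (Loop P) G) (Run (Loop P) H)"
| loop2: "(step True)\<^sup>+\<^sup>+ (Run P G) Failed \<Longrightarrow> step b (Run (Loop P) G) (Done G)"
| loop3: "(step True)\<^sup>*\<^sup>* (Run P G) (Run Break H) \<Longrightarrow> step b (Run (Loop P) G) (Done H)"

text \<open>An execution can also get stuck: this happens if the condition of a branching
  command or the body of a loop admits divergent executions only, and it counts as
  divergence.\<close>

definition can_diverge :: "prog \<Rightarrow> host \<Rightarrow> bool" where
  "can_diverge P G \<longleftrightarrow>
     (\<exists>f. f 0 = Run P G \<and> (\<forall>i. step False (f i) (f (Suc i)))) \<or>
     (\<exists>Q H. (step False)\<^sup>*\<^sup>* (Run P G) (Run Q H) \<and> (\<nexists>c. step False (Run Q H) c))"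

datatype outcome = Graph host | Fail | Bottom

definition sem :: "prog \<Rightarrow> host \<Rightarrow> outcome set" where
  "sem P G = {Graph H | H. (step False)\<^sup>+\<^sup>+ (Run P G) (Done H)} \<union>
     (if (step False)\<^sup>+\<^sup>+ (Run P G) Failed then {Fail} else {}) \<union>
     (if can_diverge P G then {Bottom} else {})"


section \<open>First-order formulas over host graphs\<close>

text \<open>Edge terms are just edge variables.\<close>

datatype nterm = NVar nat | NSrc nat | NTgt nat

datatype lterm =
    TEmpty
  | TAtom "nterm aexp"
  | TVar nat
  | TConc lterm lterm
  | TLabV nterm
  | TLabE nat

datatype nmterm = NMConst nmark | NMark nterm
datatype emterm = EMConst emark | EMark nat

text \<open>\<open>FExL x\<close> quantifies over the lists in the domain of \<open>x\<close>; for a variable of type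
  int, say, this is quantification over the lists \<open>l\<close> that satisfy \<open>int(l)\<close>.\<close>

datatype form =
    FTrue
  | FFalse
  | FInt lterm
  | FChar lterm
  | FString lterm
  | FAtom lterm
  | FRoot nterm
  | FEqL lterm lterm
  | FRel rel "nterm iexp" "nterm iexp"
  | FEqN nterm nterm
  | FEqE nat nat
  | FEqNM nmterm nmterm
  | FEqEM emterm emterm
  | FNot form
  | FAnd form form
  | FOr form form
  | FExV nat form
  | FExE nat form
  | FExL var form

datatype fvar = NodeV nat | EdgeV nat | LabelV var

fun fv_n :: "nterm \<Rightarrow> fvar set" where
  "fv_n (NVar x) = {NodeV x}"
| "fv_n (NSrc e) = {EdgeV e}"
| "fv_n (NTgt e) = {EdgeV e}"

definition fv_i :: "nterm iexp \<Rightarrow> fvar set" where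
  "fv_i a = LabelV ` ivars a \<union> (\<Union>n \<in> set_iexp a. fv_n n)"

definition fv_a :: "nterm aexp \<Rightarrow> fvar set" where
  "fv_a a = LabelV ` avars a \<union> (\<Union>n \<in> set_aexp a. fv_n n)"

fun fv_l :: "lterm \<Rightarrow> fvar set" where
  "fv_l TEmpty = {}"
| "fv_l (TAtom a) = fv_a a"
| "fv_l (TVar x) = {LabelV (ListVar x)}"
| "fv_l (TConc s t) = fv_l s \<union> fv_l t"
| "fv_l (TLabV n) = fv_n n"
| "fv_l (TLabE e) = {EdgeV e}"

fun fv_nm :: "nmterm \<Rightarrow> fvar set" where
  "fv_nm (NMConst _) = {}"
| "fv_nm (NMark n) = fv_n n"

fun fv_em :: "emterm \<Rightarrow> fvar set" where
  "fv_em (EMConst _) = {}"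
| "fv_em (EMark e) = {EdgeV e}"

fun fv :: "form \<Rightarrow> fvar set" where
  "fv FTrue = {}"
| "fv FFalse = {}"
| "fv (FInt t) = fv_l t"
| "fv (FChar t) = fv_l t"
| "fv (FString t) = fv_l t"
| "fv (FAtom t) = fv_l t"
| "fv (FRoot n) = fv_n n"
| "fv (FEqL s t) = fv_l s \<union> fv_l t"
| "fv (FRel _ a b) = fv_i a \<union> fv_i b"
| "fv (FEqN m n) = fv_n m \<union> fv_n n"
| "fv (FEqE d e) = {EdgeV d, EdgeV e}"
| "fv (FEqNM s t) = fv_nm s \<union> fv_nm t"
| "fv (FEqEM s t) = fv_em s \<union> fv_em t"
| "fv (FNot c) = fv c"
| "fv (FAnd c d) = fv c \<union> fv d"
| "fv (FOr c d) = fv c \<union> fv d"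
| "fv (FExV x c) = fv c - {NodeV x}"
| "fv (FExE x c) = fv c - {EdgeV x}"
| "fv (FExL x c) = fv c - {LabelV x}"

definition closed_form :: "form \<Rightarrow> bool" where
  "closed_form c \<longleftrightarrow> fv c = {}"

fun neval :: "host \<Rightarrow> (nat \<Rightarrow> nat) \<Rightarrow> (nat \<Rightarrow> nat) \<Rightarrow> nterm \<Rightarrow> nat" where
  "neval G \<nu> \<epsilon> (NVar x) = \<nu> x"
| "neval G \<nu> \<epsilon> (NSrc e) = src G (\<epsilon> e)"
| "neval G \<nu> \<epsilon> (NTgt e) = tgt G (\<epsilon> e)"

abbreviation fieval ::
    "host \<Rightarrow> (nat \<Rightarrow> nat) \<Rightarrow> (nat \<Rightarrow> nat) \<Rightarrow> assignment \<Rightarrow> nterm iexp \<Rightarrow> int" where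
  "fieval G \<nu> \<epsilon> \<equiv> ieval (\<lambda>n. indeg G (neval G \<nu> \<epsilon> n)) (\<lambda>n. outdeg G (neval G \<nu> \<epsilon> n))"

abbreviation faeval ::
    "host \<Rightarrow> (nat \<Rightarrow> nat) \<Rightarrow> (nat \<Rightarrow> nat) \<Rightarrow> assignment \<Rightarrow> nterm aexp \<Rightarrow> hlist" where
  "faeval G \<nu> \<epsilon> \<equiv> aeval (\<lambda>n. indeg G (neval G \<nu> \<epsilon> n)) (\<lambda>n. outdeg G (neval G \<nu> \<epsilon> n))"

fun teval :: "host \<Rightarrow> (nat \<Rightarrow> nat) \<Rightarrow> (nat \<Rightarrow> nat) \<Rightarrow> assignment \<Rightarrow> lterm \<Rightarrow> hlist" where
  "teval G \<nu> \<epsilon> \<alpha> TEmpty = []"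
| "teval G \<nu> \<epsilon> \<alpha> (TAtom a) = faeval G \<nu> \<epsilon> \<alpha> a"
| "teval G \<nu> \<epsilon> \<alpha> (TVar x) = \<alpha> (ListVar x)"
| "teval G \<nu> \<epsilon> \<alpha> (TConc s t) = teval G \<nu> \<epsilon> \<alpha> s @ teval G \<nu> \<epsilon> \<alpha> t"
| "teval G \<nu> \<epsilon> \<alpha> (TLabV n) = nlabel G (neval G \<nu> \<epsilon> n)"
| "teval G \<nu> \<epsilon> \<alpha> (TLabE e) = elabel G (\<epsilon> e)"

fun nmeval :: "host \<Rightarrow> (nat \<Rightarrow> nat) \<Rightarrow> (nat \<Rightarrow> nat) \<Rightarrow> nmterm \<Rightarrow> nmark" where
  "nmeval G \<nu> \<epsilon> (NMConst m) = m"
| "nmeval G \<nu> \<epsilon> (NMark n) = nmark G (neval G \<nu> \<epsilon> n)"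

fun emeval :: "host \<Rightarrow> (nat \<Rightarrow> nat) \<Rightarrow> emterm \<Rightarrow> emark" where
  "emeval G \<epsilon> (EMConst m) = m"
| "emeval G \<epsilon> (EMark e) = emark G (\<epsilon> e)"

fun sat :: "host \<Rightarrow> (nat \<Rightarrow> nat) \<Rightarrow> (nat \<Rightarrow> nat) \<Rightarrow> assignment \<Rightarrow> form \<Rightarrow> bool" where
  "sat G \<nu> \<epsilon> \<alpha> FTrue = True"
| "sat G \<nu> \<epsilon> \<alpha> FFalse = False"
| "sat G \<nu> \<epsilon> \<alpha> (FInt t) = is_int (teval G \<nu> \<epsilon> \<alpha> t)"
| "sat G \<nu> \<epsilon> \<alpha> (FChar t) = is_char (teval G \<nu> \<epsilon> \<alpha> t)"
| "sat G \<nu> \<epsilon> \<alpha> (FString t) = is_string (teval G \<nu> \<epsilon> \<alpha> t)"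
| "sat G \<nu> \<epsilon> \<alpha> (FAtom t) = is_atom (teval G \<nu> \<epsilon> \<alpha> t)"
| "sat G \<nu> \<epsilon> \<alpha> (FRoot n) = rooted G (neval G \<nu> \<epsilon> n)"
| "sat G \<nu> \<epsilon> \<alpha> (FEqL s t) = (teval G \<nu> \<epsilon> \<alpha> s = teval G \<nu> \<epsilon> \<alpha> t)"
| "sat G \<nu> \<epsilon> \<alpha> (FRel r a b) = rel_holds r (fieval G \<nu> \<epsilon> \<alpha> a) (fieval G \<nu> \<epsilon> \<alpha> b)"
| "sat G \<nu> \<epsilon> \<alpha> (FEqN m n) = (neval G \<nu> \<epsilon> m = neval G \<nu> \<epsilon> n)"
| "sat G \<nu> \<epsilon> \<alpha> (FEqE d e) = (\<epsilon> d = \<epsilon> e)"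
| "sat G \<nu> \<epsilon> \<alpha> (FEqNM s t) = (nmeval G \<nu> \<epsilon> s = nmeval G \<nu> \<epsilon> t)"
| "sat G \<nu> \<epsilon> \<alpha> (FEqEM s t) = (emeval G \<epsilon> s = emeval G \<epsilon> t)"
| "sat G \<nu> \<epsilon> \<alpha> (FNot c) = (\<not> sat G \<nu> \<epsilon> \<alpha> c)"
| "sat G \<nu> \<epsilon> \<alpha> (FAnd c d) = (sat G \<nu> \<epsilon> \<alpha> c \<and> sat G \<nu> \<epsilon> \<alpha> d)"
| "sat G \<nu> \<epsilon> \<alpha> (FOr c d) = (sat G \<nu> \<epsilon> \<alpha> c \<or> sat G \<nu> \<epsilon> \<alpha> d)"
| "sat G \<nu> \<epsilon> \<alpha> (FExV x c) = (\<exists>v \<in> nodes G. sat G (\<nu>(x := v)) \<epsilon> \<alpha> c)"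
| "sat G \<nu> \<epsilon> \<alpha> (FExE x c) = (\<exists>e \<in> edges G. sat G \<nu> (\<epsilon>(x := e)) \<alpha> c)"
| "sat G \<nu> \<epsilon> \<alpha> (FExL x c) = (\<exists>l \<in> vdom x. sat G \<nu> \<epsilon> (\<alpha>(x := l)) c)"

text \<open>For closed formulas the choice of the assignments is irrelevant.\<close>

definition models :: "host \<Rightarrow> form \<Rightarrow> bool" (infix \<open>\<Turnstile>\<close> 50) where
  "G \<Turnstile> c \<longleftrightarrow> (\<forall>\<nu> \<epsilon> \<alpha>. sat G \<nu> \<epsilon> \<alpha> c)"

end

theory Submission
  imports Defs
begin

text \<open>Call a property of host graphs expressible if it is defined by a closed formula.
  The key fact is that the existential precondition
  \<open>\<lambda>G. \<exists>H. derives G r H \<and> \<Phi> H\<close> of an expressible property \<open>\<Phi>\<close> is expressible: quantify over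
  the nodes, edges and variables of the left-hand graph, state that they form a match,
  and rewrite the formula for \<open>\<Phi>\<close> into one evaluated in \<open>G\<close>. A node or edge quantifier over
  \<open>H\<close> becomes a quantifier over the items of \<open>G\<close> outside the match together with a finite
  disjunction over the items of the right-hand graph, whose labels, marks and degrees are
  known in terms of the match. Induction on loop-free programs then expresses both ``can
  fail'' and the precondition ``can terminate in a graph satisfying \<open>\<Phi>\<close>''; non-failing
  commands never fail, and sequential composition combines the two.\<close>

section \<open>Finite conjunctions, quantifier blocks and coincidence\<close>

text \<open>The obstacle is that the given formula talks about \<open>H\<close>, while its
  replacement may only talk about \<open>G\<close>. A created node does not exist in
  \<open>G\<close>, and a preserved one may have another label, mark or degree there, so replacing
  terms by terms cannot work. Which kind of item a variable denotes is therefore settled at its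
  quantifier, and for an edge the kinds of both end points are settled along with it. Below the
  quantifiers every node term is then either a term over \<open>G\<close> or a known node of the
  right-hand graph.

  The identifiers chosen for new items never enter the translation. All results of one match thus
  behave alike, and the quantifier over \<open>H\<close> reduces to one over matches.

  Loops get no precondition at all: \<open>iteration_command\<close> admits them only inside
  non-failing commands, whose failure formula is simply false.\<close>

definition list_of :: "'a set \<Rightarrow> 'a list" where
  "list_of A = (SOME xs. set xs = A)"

lemma set_list_of [simp]: "finite A \<Longrightarrow> set (list_of A) = A"
  unfolding list_of_def by (rule someI_ex) (rule finite_list)

text \<open>Rule graphs carry sets of items, so an arbitrary enumeration is folded. For an infinite
  set it is unspecified, hence the finiteness assumptions in the facts about \<open>FConj\<close>
  and \<open>FDisj\<close>.\<close>

definition FConj :: "'a set \<Rightarrow> ('a \<Rightarrow> form) \<Rightarrow> form" where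
  "FConj A f = foldr FAnd (map f (list_of A)) FTrue"

definition FDisj :: "'a set \<Rightarrow> ('a \<Rightarrow> form) \<Rightarrow> form" where
  "FDisj A f = foldr FOr (map f (list_of A)) FFalse"

text \<open>Meant for facts that are settled when the formula is built, such as the rootedness of a
  right-hand node.\<close>

definition fbool :: "bool \<Rightarrow> form" where
  "fbool b = (if b then FTrue else FFalse)"

lemma sat_fbool [simp]: "sat G \<nu> \<epsilon> \<alpha> (fbool b) = b"
  by (simp add: fbool_def)

lemma fv_fbool [simp]: "fv (fbool b) = {}"
  by (simp add: fbool_def)

lemma sat_FConj [simp]:
  assumes "finite A"
  shows "sat G \<nu> \<epsilon> \<alpha> (FConj A f) \<longleftrightarrow> (\<forall>a \<in> A. sat G \<nu> \<epsilon> \<alpha> (f a))"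
proof -
  have "sat G \<nu> \<epsilon> \<alpha> (foldr FAnd (map f xs) FTrue) \<longleftrightarrow> (\<forall>a \<in> set xs. sat G \<nu> \<epsilon> \<alpha> (f a))" for xs
    by (induction xs) auto
  then show ?thesis using assms by (simp add: FConj_def)
qed

lemma sat_FDisj [simp]:
  assumes "finite A"
  shows "sat G \<nu> \<epsilon> \<alpha> (FDisj A f) \<longleftrightarrow> (\<exists>a \<in> A. sat G \<nu> \<epsilon> \<alpha> (f a))"
proof -
  have "sat G \<nu> \<epsilon> \<alpha> (foldr FOr (map f xs) FFalse) \<longleftrightarrow> (\<exists>a \<in> set xs. sat G \<nu> \<epsilon> \<alpha> (f a))" for xs
    by (induction xs) auto
  then show ?thesis using assms by (simp add: FDisj_def)
qed

lemma fv_FConj [simp]: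
  assumes "finite A"
  shows "fv (FConj A f) = (\<Union>a \<in> A. fv (f a))"
proof -
  have "fv (foldr FAnd (map f xs) FTrue) = (\<Union>a \<in> set xs. fv (f a))" for xs
    by (induction xs) auto
  then show ?thesis using assms by (simp add: FConj_def)
qed

lemma fv_FDisj [simp]:
  assumes "finite A"
  shows "fv (FDisj A f) = (\<Union>a \<in> A. fv (f a))"
proof -
  have "fv (foldr FOr (map f xs) FFalse) = (\<Union>a \<in> set xs. fv (f a))" for xs
    by (induction xs) auto
  then show ?thesis using assms by (simp add: FDisj_def)
qed

section \<open>Blocks of existential quantifiers\<close>

lemma sat_FExV_block:
  "sat G \<nu> \<epsilon> \<alpha> (foldr FExV xs c) \<longleftrightarrow>
   (\<exists>\<nu>'. (\<forall>x \<in> set xs. \<nu>' x \<in> nodes G) \<and> (\<forall>x. x \<notin> set xs \<longrightarrow> \<nu>' x = \<nu> x) \<and> sat G \<nu>' \<epsilon> \<alpha> c)"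
  (is "_ = ?block xs \<nu>")
proof (induction xs arbitrary: \<nu>)
  case Nil
  have "(\<forall>x. \<nu>' x = \<nu> x) \<longleftrightarrow> \<nu>' = \<nu>" for \<nu>' by auto
  then show ?case by simp
next
  case (Cons y xs)
  have "?block (y # xs) \<nu> \<longleftrightarrow> (\<exists>v \<in> nodes G. ?block xs (\<nu>(y := v)))" (is "?l \<longleftrightarrow> ?r")
  proof
    assume ?l
    then obtain \<nu>' where "\<forall>x \<in> set (y # xs). \<nu>' x \<in> nodes G"
      "\<forall>x. x \<notin> set (y # xs) \<longrightarrow> \<nu>' x = \<nu> x" "sat G \<nu>' \<epsilon> \<alpha> c" by blast
    then show ?r by (intro bexI [of _ "\<nu>' y"] exI [of _ \<nu>']) auto
  next
    assume ?r
    then obtain v \<nu>' where "v \<in> nodes G" "\<forall>x \<in> set xs. \<nu>' x \<in> nodes G"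
      "\<forall>x. x \<notin> set xs \<longrightarrow> \<nu>' x = (\<nu>(y := v)) x" "sat G \<nu>' \<epsilon> \<alpha> c" by blast
    \<comment> \<open>Enumerations may repeat names: if \<open>y\<close> recurs in
      \<open>xs\<close>, the inner binding overrides \<open>v\<close>; otherwise
      \<open>\<nu>' y = v\<close>.\<close>
    then show ?l by (intro exI [of _ \<nu>']) (cases "y \<in> set xs"; auto)
  qed
  with Cons.IH show ?case by simp
qed

lemma sat_FExE_block:
  "sat G \<nu> \<epsilon> \<alpha> (foldr FExE xs c) \<longleftrightarrow>
   (\<exists>\<epsilon>'. (\<forall>x \<in> set xs. \<epsilon>' x \<in> edges G) \<and> (\<forall>x. x \<notin> set xs \<longrightarrow> \<epsilon>' x = \<epsilon> x) \<and> sat G \<nu> \<epsilon>' \<alpha> c)"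
  (is "_ = ?block xs \<epsilon>")
proof (induction xs arbitrary: \<epsilon>)
  case Nil
  have "(\<forall>x. \<epsilon>' x = \<epsilon> x) \<longleftrightarrow> \<epsilon>' = \<epsilon>" for \<epsilon>' by auto
  then show ?case by simp
next
  case (Cons y xs)
  have "?block (y # xs) \<epsilon> \<longleftrightarrow> (\<exists>v \<in> edges G. ?block xs (\<epsilon>(y := v)))" (is "?l \<longleftrightarrow> ?r")
  proof
    assume ?l
    then obtain \<epsilon>' where "\<forall>x \<in> set (y # xs). \<epsilon>' x \<in> edges G"
      "\<forall>x. x \<notin> set (y # xs) \<longrightarrow> \<epsilon>' x = \<epsilon> x" "sat G \<nu> \<epsilon>' \<alpha> c" by blast
    then show ?r by (intro bexI [of _ "\<epsilon>' y"] exI [of _ \<epsilon>']) auto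
  next
    assume ?r
    then obtain v \<epsilon>' where "v \<in> edges G" "\<forall>x \<in> set xs. \<epsilon>' x \<in> edges G"
      "\<forall>x. x \<notin> set xs \<longrightarrow> \<epsilon>' x = (\<epsilon>(y := v)) x" "sat G \<nu> \<epsilon>' \<alpha> c" by blast
    then show ?l by (intro exI [of _ \<epsilon>']) (cases "y \<in> set xs"; auto)
  qed
  with Cons.IH show ?case by simp
qed

lemma sat_FExL_block:
  "sat G \<nu> \<epsilon> \<alpha> (foldr FExL xs c) \<longleftrightarrow>
   (\<exists>\<alpha>'. (\<forall>x \<in> set xs. \<alpha>' x \<in> vdom x) \<and> (\<forall>x. x \<notin> set xs \<longrightarrow> \<alpha>' x = \<alpha> x) \<and> sat G \<nu> \<epsilon> \<alpha>' c)"
  (is "_ = ?block xs \<alpha>")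
proof (induction xs arbitrary: \<alpha>)
  case Nil
  have "(\<forall>x. \<alpha>' x = \<alpha> x) \<longleftrightarrow> \<alpha>' = \<alpha>" for \<alpha>' by auto
  then show ?case by simp
next
  case (Cons y xs)
  have "?block (y # xs) \<alpha> \<longleftrightarrow> (\<exists>l \<in> vdom y. ?block xs (\<alpha>(y := l)))" (is "?l \<longleftrightarrow> ?r")
  proof
    assume ?l
    then obtain \<alpha>' where "\<forall>x \<in> set (y # xs). \<alpha>' x \<in> vdom x"
      "\<forall>x. x \<notin> set (y # xs) \<longrightarrow> \<alpha>' x = \<alpha> x" "sat G \<nu> \<epsilon> \<alpha>' c" by blast
    then show ?r by (intro bexI [of _ "\<alpha>' y"] exI [of _ \<alpha>']) auto
  next
    assume ?r
    then obtain l \<alpha>' where "l \<in> vdom y" "\<forall>x \<in> set xs. \<alpha>' x \<in> vdom x"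
      "\<forall>x. x \<notin> set xs \<longrightarrow> \<alpha>' x = (\<alpha>(y := l)) x" "sat G \<nu> \<epsilon> \<alpha>' c" by blast
    then show ?l by (intro exI [of _ \<alpha>']) (cases "y \<in> set xs"; auto)
  qed
  with Cons.IH show ?case by simp
qed

lemma fv_FExV_block [simp]: "fv (foldr FExV xs c) = fv c - NodeV ` set xs"
  by (induction xs) auto

lemma fv_FExE_block [simp]: "fv (foldr FExE xs c) = fv c - EdgeV ` set xs"
  by (induction xs) auto

lemma fv_FExL_block [simp]: "fv (foldr FExL xs c) = fv c - LabelV ` set xs"
  by (induction xs) auto

section \<open>Coincidence: truth depends on the free variables only\<close>

lemma ieval_cong:
  assumes "\<And>n. n \<in> set_iexp a \<Longrightarrow> ind n = ind' n" "\<And>n. n \<in> set_iexp a \<Longrightarrow> outd n = outd' n"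
    "\<And>x. x \<in> ivars a \<Longrightarrow> \<alpha> x = \<alpha>' x"
  shows "ieval ind outd \<alpha> a = ieval ind' outd' \<alpha>' a"
  using assms by (induction a) auto

lemma seval_cong: "(\<And>x. x \<in> svars s \<Longrightarrow> \<alpha> x = \<alpha>' x) \<Longrightarrow> seval \<alpha> s = seval \<alpha>' s"
  by (induction s) auto

lemma aeval_cong:
  assumes "\<And>n. n \<in> set_aexp a \<Longrightarrow> ind n = ind' n" "\<And>n. n \<in> set_aexp a \<Longrightarrow> outd n = outd' n"
    "\<And>x. x \<in> avars a \<Longrightarrow> \<alpha> x = \<alpha>' x"
  shows "aeval ind outd \<alpha> a = aeval ind' outd' \<alpha>' a"
  using assms by (cases a) (auto intro: ieval_cong seval_cong)

lemma leval_cong: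
  assumes "\<And>n. n \<in> set_lexp l \<Longrightarrow> ind n = ind' n" "\<And>n. n \<in> set_lexp l \<Longrightarrow> outd n = outd' n"
    "\<And>x. x \<in> lvars l \<Longrightarrow> \<alpha> x = \<alpha>' x"
  shows "leval ind outd \<alpha> l = leval ind' outd' \<alpha>' l"
  using assms by (induction l) (auto intro!: aeval_cong)

lemma finite_ivars [simp]: "finite (ivars a)"
  by (induction a) auto

lemma finite_svars [simp]: "finite (svars s)"
  by (induction s) auto

lemma finite_lvars [simp]: "finite (lvars l)"
proof (induction l)
  case (LAtom a)
  then show ?case by (cases a) auto
qed auto

lemma fv_i_simps [simp]:
  "fv_i (Num i) = {}" "fv_i (IVar x) = {LabelV (IntVar x)}"
  "fv_i (Add a b) = fv_i a \<union> fv_i b" "fv_i (Sub a b) = fv_i a \<union> fv_i b"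
  "fv_i (Mul a b) = fv_i a \<union> fv_i b" "fv_i (Div a b) = fv_i a \<union> fv_i b"
  "fv_i (Indeg n) = fv_n n" "fv_i (Outdeg n) = fv_n n" "fv_i (Length y) = {LabelV y}"
  by (auto simp: fv_i_def)

lemma fv_a_simps [simp]:
  "fv_a (AInt a) = fv_i a" "fv_a (AStr s) = LabelV ` svars s" "fv_a (AVar x) = {LabelV (AtomVar x)}"
  by (auto simp: fv_i_def fv_a_def)

text \<open>Stated for an arbitrary set \<open>F\<close>, so that the assumption for a whole formula
  can be used directly for each of its terms.\<close>

definition agree_on ::
    "fvar set \<Rightarrow> (nat \<Rightarrow> nat) \<times> (nat \<Rightarrow> nat) \<times> assignment \<Rightarrow>
     (nat \<Rightarrow> nat) \<times> (nat \<Rightarrow> nat) \<times> assignment \<Rightarrow> bool" where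
  "agree_on F = (\<lambda>(\<nu>, \<epsilon>, \<alpha>) (\<nu>', \<epsilon>', \<alpha>').
     (\<forall>x. NodeV x \<in> F \<longrightarrow> \<nu> x = \<nu>' x) \<and> (\<forall>x. EdgeV x \<in> F \<longrightarrow> \<epsilon> x = \<epsilon>' x) \<and>
     (\<forall>x. LabelV x \<in> F \<longrightarrow> \<alpha> x = \<alpha>' x))"

lemma agree_on_mono: "agree_on F a b \<Longrightarrow> F' \<subseteq> F \<Longrightarrow> agree_on F' a b"
  by (auto simp: agree_on_def)

lemma neval_coincidence:
  "agree_on F (\<nu>, \<epsilon>, \<alpha>) (\<nu>', \<epsilon>', \<alpha>') \<Longrightarrow> fv_n n \<subseteq> F \<Longrightarrow> neval G \<nu> \<epsilon> n = neval G \<nu>' \<epsilon>' n"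
  by (cases n) (auto simp: agree_on_def)

lemma fieval_coincidence:
  assumes "agree_on F (\<nu>, \<epsilon>, \<alpha>) (\<nu>', \<epsilon>', \<alpha>')" "fv_i a \<subseteq> F"
  shows "fieval G \<nu> \<epsilon> \<alpha> a = fieval G \<nu>' \<epsilon>' \<alpha>' a"
proof (rule ieval_cong)
  fix n assume "n \<in> set_iexp a"
  with assms(2) have "fv_n n \<subseteq> F" by (auto simp: fv_i_def)
  from neval_coincidence [OF assms(1) this]
  show "indeg G (neval G \<nu> \<epsilon> n) = indeg G (neval G \<nu>' \<epsilon>' n)"
    "outdeg G (neval G \<nu> \<epsilon> n) = outdeg G (neval G \<nu>' \<epsilon>' n)" by simp_all
next
  fix x assume "x \<in> ivars a"
  with assms show "\<alpha> x = \<alpha>' x" by (auto simp: fv_i_def agree_on_def)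
qed

lemma faeval_coincidence:
  assumes "agree_on F (\<nu>, \<epsilon>, \<alpha>) (\<nu>', \<epsilon>', \<alpha>')" "fv_a a \<subseteq> F"
  shows "faeval G \<nu> \<epsilon> \<alpha> a = faeval G \<nu>' \<epsilon>' \<alpha>' a"
proof (rule aeval_cong)
  fix n assume "n \<in> set_aexp a"
  with assms(2) have "fv_n n \<subseteq> F" by (auto simp: fv_a_def)
  from neval_coincidence [OF assms(1) this]
  show "indeg G (neval G \<nu> \<epsilon> n) = indeg G (neval G \<nu>' \<epsilon>' n)"
    "outdeg G (neval G \<nu> \<epsilon> n) = outdeg G (neval G \<nu>' \<epsilon>' n)" by simp_all
next
  fix x assume "x \<in> avars a"
  with assms show "\<alpha> x = \<alpha>' x" by (auto simp: fv_a_def agree_on_def)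
qed

lemma teval_coincidence:
  assumes "agree_on F (\<nu>, \<epsilon>, \<alpha>) (\<nu>', \<epsilon>', \<alpha>')" "fv_l t \<subseteq> F"
  shows "teval G \<nu> \<epsilon> \<alpha> t = teval G \<nu>' \<epsilon>' \<alpha>' t"
  using assms(2)
proof (induction t)
  case (TAtom a)
  then show ?case using faeval_coincidence [OF assms(1)] by simp
next
  case (TLabV n)
  then show ?case using neval_coincidence [OF assms(1)] by simp
qed (use assms(1) in \<open>auto simp: agree_on_def\<close>)

lemma sat_coincidence:
  "agree_on (fv c) (\<nu>, \<epsilon>, \<alpha>) (\<nu>', \<epsilon>', \<alpha>') \<Longrightarrow> sat G \<nu> \<epsilon> \<alpha> c = sat G \<nu>' \<epsilon>' \<alpha>' c"
proof (induction c arbitrary: \<nu> \<epsilon> \<alpha> \<nu>' \<epsilon>' \<alpha>')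
  case (FEqL s t)
  then show ?case using teval_coincidence [OF FEqL, of s] teval_coincidence [OF FEqL, of t] by simp
next
  case (FRel q a b)
  then show ?case using fieval_coincidence [OF FRel, of a] fieval_coincidence [OF FRel, of b] by simp
next
  case (FEqN m n)
  then show ?case using neval_coincidence [OF FEqN, of m] neval_coincidence [OF FEqN, of n] by simp
next
  case (FEqNM s t)
  have "nmeval G \<nu> \<epsilon> u = nmeval G \<nu>' \<epsilon>' u" if "fv_nm u \<subseteq> fv (FEqNM s t)" for u
    using neval_coincidence [OF FEqNM] that by (cases u) auto
  from this [of s] this [of t] show ?case by simp
next
  case (FEqEM s t)
  have "emeval G \<epsilon> u = emeval G \<epsilon>' u" if "fv_em u \<subseteq> fv (FEqEM s t)" for u
    using FEqEM that by (cases u) (auto simp: agree_on_def)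
  from this [of s] this [of t] show ?case by simp
next
  case (FNot c)
  then have "sat G \<nu> \<epsilon> \<alpha> c = sat G \<nu>' \<epsilon>' \<alpha>' c" by simp
  then show ?case by simp
next
  case (FAnd c d)
  have "sat G \<nu> \<epsilon> \<alpha> c = sat G \<nu>' \<epsilon>' \<alpha>' c" "sat G \<nu> \<epsilon> \<alpha> d = sat G \<nu>' \<epsilon>' \<alpha>' d"
    using FAnd.prems by (auto intro!: FAnd.IH elim!: agree_on_mono)
  then show ?case by simp
next
  case (FOr c d)
  have "sat G \<nu> \<epsilon> \<alpha> c = sat G \<nu>' \<epsilon>' \<alpha>' c" "sat G \<nu> \<epsilon> \<alpha> d = sat G \<nu>' \<epsilon>' \<alpha>' d"
    using FOr.prems by (auto intro!: FOr.IH elim!: agree_on_mono)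
  then show ?case by simp
next
  case (FExV x c)
  have "sat G (\<nu>(x := v)) \<epsilon> \<alpha> c = sat G (\<nu>'(x := v)) \<epsilon>' \<alpha>' c" for v
    using FExV.prems by (intro FExV.IH) (auto simp: agree_on_def)
  then show ?case by simp
next
  case (FExE x c)
  have "sat G \<nu> (\<epsilon>(x := v)) \<alpha> c = sat G \<nu>' (\<epsilon>'(x := v)) \<alpha>' c" for v
    using FExE.prems by (intro FExE.IH) (auto simp: agree_on_def)
  then show ?case by simp
next
  case (FExL x c)
  have "sat G \<nu> \<epsilon> (\<alpha>(x := v)) c = sat G \<nu>' \<epsilon>' (\<alpha>'(x := v)) c" for v
    using FExL.prems by (intro FExL.IH) (auto simp: agree_on_def)
  then show ?case by simp
next
  case (FInt t)
  then show ?case using teval_coincidence [OF FInt] by simp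
next
  case (FChar t)
  then show ?case using teval_coincidence [OF FChar] by simp
next
  case (FString t)
  then show ?case using teval_coincidence [OF FString] by simp
next
  case (FAtom t)
  then show ?case using teval_coincidence [OF FAtom] by simp
next
  case (FRoot n)
  then show ?case using neval_coincidence [OF FRoot] by simp
qed (auto simp: agree_on_def)

lemma models_closed: "closed_form c \<Longrightarrow> G \<Turnstile> c \<longleftrightarrow> sat G \<nu> \<epsilon> \<alpha> c"
proof -
  assume "closed_form c"
  then have "agree_on (fv c) (\<nu>, \<epsilon>, \<alpha>) (\<nu>', \<epsilon>', \<alpha>')" for \<nu>' \<epsilon>' \<alpha>'
    by (simp add: closed_form_def agree_on_def)
  then have "sat G \<nu> \<epsilon> \<alpha> c = sat G \<nu>' \<epsilon>' \<alpha>' c" for \<nu>' \<epsilon>' \<alpha>'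
    by (rule sat_coincidence)
  then show ?thesis unfolding models_def by blast
qed

section \<open>Definable properties and their Boolean closure\<close>

definition expressible :: "(host \<Rightarrow> bool) \<Rightarrow> bool" where
  "expressible \<Phi> \<longleftrightarrow> (\<exists>c. closed_form c \<and> (\<forall>G. host_graph G \<longrightarrow> (G \<Turnstile> c \<longleftrightarrow> \<Phi> G)))"

text \<open>By coincidence one assignment decides a closed formula. The freedom to choose it for
  each graph matters: \<open>models\<close> also ranges over ill-typed label assignments, whereas
  \<open>match_form\<close> is shown to be adequate at well-typed ones.\<close>

lemma expressibleI:
  assumes "fv c = {}" "\<And>G. host_graph G \<Longrightarrow> \<exists>\<nu> \<epsilon> \<alpha>. sat G \<nu> \<epsilon> \<alpha> c \<longleftrightarrow> \<Phi> G"
  shows "expressible \<Phi>"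
proof -
  have c: "closed_form c" using assms(1) by (simp add: closed_form_def)
  have "G \<Turnstile> c \<longleftrightarrow> \<Phi> G" if "host_graph G" for G
    using assms(2) [OF that] models_closed [OF c] by blast
  with c show ?thesis by (auto simp: expressible_def)
qed

lemma expressibleE:
  assumes "expressible \<Phi>"
  obtains c where "fv c = {}" "\<And>G \<nu> \<epsilon> \<alpha>. host_graph G \<Longrightarrow> sat G \<nu> \<epsilon> \<alpha> c \<longleftrightarrow> \<Phi> G"
proof -
  obtain c where c: "closed_form c" "\<forall>G. host_graph G \<longrightarrow> (G \<Turnstile> c \<longleftrightarrow> \<Phi> G)"
    using assms by (auto simp: expressible_def)
  show thesis
    by (rule that [of c]) (use c models_closed [OF c(1)] in \<open>auto simp: closed_form_def\<close>)
qed

lemma expressible_const: "expressible (\<lambda>_. b)"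
  by (rule expressibleI [of "fbool b"]) auto

lemma expressible_not:
  assumes "expressible \<Phi>"
  shows "expressible (\<lambda>G. \<not> \<Phi> G)"
proof -
  obtain c where c: "fv c = {}" "\<And>G \<nu> \<epsilon> \<alpha>. host_graph G \<Longrightarrow> sat G \<nu> \<epsilon> \<alpha> c \<longleftrightarrow> \<Phi> G"
    using expressibleE [OF assms] by blast
  show ?thesis by (rule expressibleI [of "FNot c"]) (simp_all add: c)
qed

lemma expressible_conj:
  assumes "expressible \<Phi>" "expressible \<Psi>"
  shows "expressible (\<lambda>G. \<Phi> G \<and> \<Psi> G)"
proof -
  obtain c where c: "fv c = {}" "\<And>G \<nu> \<epsilon> \<alpha>. host_graph G \<Longrightarrow> sat G \<nu> \<epsilon> \<alpha> c \<longleftrightarrow> \<Phi> G"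
    using expressibleE [OF assms(1)] by blast
  obtain d where d: "fv d = {}" "\<And>G \<nu> \<epsilon> \<alpha>. host_graph G \<Longrightarrow> sat G \<nu> \<epsilon> \<alpha> d \<longleftrightarrow> \<Psi> G"
    using expressibleE [OF assms(2)] by blast
  show ?thesis by (rule expressibleI [of "FAnd c d"]) (simp_all add: c d)
qed

lemma expressible_disj:
  assumes "expressible \<Phi>" "expressible \<Psi>"
  shows "expressible (\<lambda>G. \<Phi> G \<or> \<Psi> G)"
proof -
  obtain c where c: "fv c = {}" "\<And>G \<nu> \<epsilon> \<alpha>. host_graph G \<Longrightarrow> sat G \<nu> \<epsilon> \<alpha> c \<longleftrightarrow> \<Phi> G"
    using expressibleE [OF assms(1)] by blast
  obtain d where d: "fv d = {}" "\<And>G \<nu> \<epsilon> \<alpha>. host_graph G \<Longrightarrow> sat G \<nu> \<epsilon> \<alpha> d \<longleftrightarrow> \<Psi> G"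
    using expressibleE [OF assms(2)] by blast
  show ?thesis by (rule expressibleI [of "FOr c d"]) (simp_all add: c d)
qed

lemma expressible_bex_list:
  "(\<And>x. x \<in> set xs \<Longrightarrow> expressible (\<Phi> x)) \<Longrightarrow> expressible (\<lambda>G. \<exists>x \<in> set xs. \<Phi> x G)"
  by (induction xs) (simp_all add: expressible_const expressible_disj)

lemma expressible_cong:
  "expressible \<Phi> \<Longrightarrow> (\<And>G. host_graph G \<Longrightarrow> \<Phi> G \<longleftrightarrow> \<Psi> G) \<Longrightarrow> expressible \<Psi>"
  by (auto simp: expressible_def)

section \<open>Describing matches by formulas\<close>

text \<open>Node identifiers of the rule become node variables of the same name, and likewise for
  edges in \<open>match_form\<close>. The two components of a match are then literally the node and
  edge assignments of the formula.\<close>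

fun rule_term :: "nat lexp \<Rightarrow> lterm" where
  "rule_term LEmpty = TEmpty"
| "rule_term (LAtom a) = TAtom (map_aexp NVar a)"
| "rule_term (LVar x) = TVar x"
| "rule_term (LConc a b) = TConc (rule_term a) (rule_term b)"

lemma ieval_map: "ieval ind outd \<alpha> (map_iexp f a) = ieval (ind \<circ> f) (outd \<circ> f) \<alpha> a"
  by (induction a) auto

lemma ivars_map [simp]: "ivars (map_iexp f a) = ivars a"
  by (induction a) auto

lemma fieval_map_NVar [simp]: "fieval G \<nu> \<epsilon> \<alpha> (map_iexp NVar a) = rieval G \<nu> \<alpha> a"
  by (simp add: ieval_map comp_def)

lemma teval_rule_term [simp]: "teval G \<nu> \<epsilon> \<alpha> (rule_term l) = rleval G \<nu> \<alpha> l"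
proof (induction l)
  case (LAtom a)
  then show ?case by (cases a) auto
qed auto

lemma fv_i_map_NVar [simp]: "fv_i (map_iexp NVar a) = LabelV ` ivars a \<union> NodeV ` set_iexp a"
  by (auto simp: fv_i_def iexp.set_map)

lemma fv_rule_term [simp]: "fv_l (rule_term l) = LabelV ` lvars l \<union> NodeV ` set_lexp l"
proof (induction l)
  case (LAtom a)
  have "avars (map_aexp f a) = avars a" for f :: "nat \<Rightarrow> nterm" by (cases a) auto
  then show ?case by (auto simp: fv_a_def aexp.set_map)
qed auto

fun var_term :: "var \<Rightarrow> lterm" where
  "var_term (IntVar x) = TAtom (AInt (IVar x))"
| "var_term (CharVar x) = TAtom (AStr (CVar x))"
| "var_term (StrVar x) = TAtom (AStr (SVar x))"
| "var_term (AtomVar x) = TAtom (AVar x)"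
| "var_term (ListVar x) = TVar x"

text \<open>For integer, character and string variables the value passes through
  \<open>the_int\<close> or \<open>the_str\<close> and is wrapped again, which recovers it if it has
  the type of the variable.\<close>

lemma teval_var_term:
  assumes "well_typed \<alpha>"
  shows "teval G \<nu> \<epsilon> \<alpha> (var_term x) = \<alpha> x"
proof -
  have "\<alpha> x \<in> vdom x" using assms by (simp add: well_typed_def)
  then show ?thesis by (cases x) (auto simp: is_int_def is_char_def is_string_def)
qed

lemma fv_var_term [simp]: "fv_l (var_term x) = {LabelV x}"
  by (cases x) (auto simp: fv_a_def)

fun nmark_form :: "nmark rmark \<Rightarrow> nterm \<Rightarrow> form" where
  "nmark_form (Mark m) t = FEqNM (NMark t) (NMConst m)"
| "nmark_form AnyMark t = FNot (FEqNM (NMark t) (NMConst NNone))"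

fun emark_form :: "emark rmark \<Rightarrow> nat \<Rightarrow> form" where
  "emark_form (Mark m) e = FEqEM (EMark e) (EMConst m)"
| "emark_form AnyMark e = FNot (FEqEM (EMark e) (EMConst ENone))"

lemma sat_nmark_form [simp]:
  "sat G \<nu> \<epsilon> \<alpha> (nmark_form k t) = mark_matches NNone k (nmark G (neval G \<nu> \<epsilon> t))"
  by (cases k) auto

lemma sat_emark_form [simp]:
  "sat G \<nu> \<epsilon> \<alpha> (emark_form k e) = mark_matches ENone k (emark G (\<epsilon> e))"
  by (cases k) auto

lemma fv_nmark_form [simp]: "fv (nmark_form k t) = fv_n t"
  by (cases k) auto

lemma fv_emark_form [simp]: "fv (emark_form k e) = {EdgeV e}"
  by (cases k) auto

text \<open>The argument \<open>N\<close> is the name of an edge variable not used otherwise.\<close>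

fun rcond_form :: "nat \<Rightarrow> rcond \<Rightarrow> form" where
  "rcond_form N (RInt x) = FInt (var_term x)"
| "rcond_form N (RChar x) = FChar (var_term x)"
| "rcond_form N (RString x) = FString (var_term x)"
| "rcond_form N (RAtom x) = FAtom (var_term x)"
| "rcond_form N (REq a b) = FEqL (rule_term a) (rule_term b)"
| "rcond_form N (RNeq a b) = FNot (FEqL (rule_term a) (rule_term b))"
| "rcond_form N (RRel q a b) = FRel q (map_iexp NVar a) (map_iexp NVar b)"
| "rcond_form N (REdge u v l k) =
     FExE N (FAnd (FAnd (FEqN (NSrc N) (NVar u)) (FEqN (NTgt N) (NVar v)))
       (FAnd (case l of None \<Rightarrow> FTrue | Some a \<Rightarrow> FEqL (TLabE N) (rule_term a))
         (case k of None \<Rightarrow> FTrue | Some m \<Rightarrow> emark_form m N)))"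
| "rcond_form N (RNot c) = FNot (rcond_form N c)"
| "rcond_form N (RAnd c d) = FAnd (rcond_form N c) (rcond_form N d)"
| "rcond_form N (ROr c d) = FOr (rcond_form N c) (rcond_form N d)"

text \<open>Rule conditions mention nodes and label variables but no edges of the rule, so binding
  the edge name \<open>N\<close> captures nothing.\<close>

lemma sat_rcond_form:
  "well_typed \<alpha> \<Longrightarrow> sat G \<nu> \<epsilon> \<alpha> (rcond_form N c) = rcond_holds G \<nu> \<alpha> c"
  by (induction c) (auto simp: teval_var_term split: option.splits)

lemma fv_rcond_form: "fv (rcond_form N c) \<subseteq> LabelV ` rcond_vars c \<union> NodeV ` rcond_nodes c"
  by (induction c) (auto split: option.splits)

text \<open>The conjuncts follow \<open>is_match\<close>. Typing of the label variables and
  membership of the images in \<open>G\<close> are missing because the enclosing quantifiers enforce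
  them; \<open>N\<close> names the arbitrary edge of the dangling condition.\<close>

definition match_form :: "nat \<Rightarrow> rule \<Rightarrow> form" where
  "match_form N r = (let L = lhs r in
     FAnd (FConj (nodes L) (\<lambda>v. FConj (nodes L - {v}) (\<lambda>w. FNot (FEqN (NVar v) (NVar w)))))
     (FAnd (FConj (edges L) (\<lambda>d. FConj (edges L - {d}) (\<lambda>e. FNot (FEqE d e))))
     (FAnd (FConj (edges L) (\<lambda>e. FAnd (FEqN (NSrc e) (NVar (src L e))) (FEqN (NTgt e) (NVar (tgt L e)))))
     (FAnd (FConj (nodes L) (\<lambda>v. FAnd (FEqL (TLabV (NVar v)) (rule_term (nlabel L v)))
        (FAnd (nmark_form (nmark L v) (NVar v))
          (if rooted L v then FRoot (NVar v) else FNot (FRoot (NVar v))))))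
     (FAnd (FConj (edges L) (\<lambda>e. FAnd (FEqL (TLabE e) (rule_term (elabel L e)))
        (emark_form (emark L e) e)))
     (FAnd (FNot (FExE N (FAnd (FConj (edges L) (\<lambda>e. FNot (FEqE N e)))
        (FDisj (nodes L - iface r) (\<lambda>v. FOr (FEqN (NSrc N) (NVar v)) (FEqN (NTgt N) (NVar v)))))))
     (case rcond r of None \<Rightarrow> FTrue | Some c \<Rightarrow> rcond_form N c)))))))"

lemma sat_match_form:
  assumes "wf_rule r" "\<forall>e \<in> edges (lhs r). e < N" "well_typed \<alpha>"
    "\<nu> ` nodes (lhs r) \<subseteq> nodes G" "\<epsilon> ` edges (lhs r) \<subseteq> edges G"
  shows "sat G \<nu> \<epsilon> \<alpha> (match_form N r) \<longleftrightarrow> is_match r G \<nu> \<epsilon> \<alpha>"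
proof -
  have fin: "finite (nodes (lhs r))" "finite (edges (lhs r))"
    using assms(1) by (auto simp: wf_rule_def wf_graph_def)
  have N: "e \<noteq> N" if "e \<in> edges (lhs r)" for e
    using that assms(2) by auto
  have inj: "inj_on f A \<longleftrightarrow> (\<forall>v \<in> A. \<forall>w \<in> A - {v}. f v \<noteq> f w)" for f :: "nat \<Rightarrow> nat" and A
    by (auto simp: inj_on_def)
  \<comment> \<open>All edge names of the rule lie below \<open>N\<close>, so rebinding
    \<open>N\<close> does not disturb the images of matched edges.\<close>
  have dangling: "sat G \<nu> \<epsilon> \<alpha> (FNot (FExE N (FAnd (FConj (edges (lhs r)) (\<lambda>e. FNot (FEqE N e)))
        (FDisj (nodes (lhs r) - iface r)
          (\<lambda>v. FOr (FEqN (NSrc N) (NVar v)) (FEqN (NTgt N) (NVar v))))))) \<longleftrightarrow>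
     (\<forall>e \<in> edges G - \<epsilon> ` edges (lhs r).
        src G e \<notin> \<nu> ` (nodes (lhs r) - iface r) \<and> tgt G e \<notin> \<nu> ` (nodes (lhs r) - iface r))"
    using fin N by auto
  have cond: "sat G \<nu> \<epsilon> \<alpha> (case rcond r of None \<Rightarrow> FTrue | Some c \<Rightarrow> rcond_form N c) \<longleftrightarrow>
     cond_holds r G \<nu> \<alpha>"
    using assms(3) by (simp add: cond_holds_def sat_rcond_form split: option.split)
  have root: "sat G \<nu> \<epsilon> \<alpha> (if b then FRoot t else FNot (FRoot t)) \<longleftrightarrow> rooted G (neval G \<nu> \<epsilon> t) = b"
    for b t by auto
  show ?thesis
    using assms(3-5) fin
    unfolding match_form_def is_match_def Let_def sat.simps(15) dangling cond
    by (simp add: inj root)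
qed

definition rule_fv :: "rule \<Rightarrow> fvar set" where
  "rule_fv r = NodeV ` nodes (lhs r) \<union> EdgeV ` edges (lhs r) \<union> LabelV ` rgraph_vars (lhs r)"

text \<open>Node identifiers occur in expressions only under degree operators, which simple
  expressions exclude. For left-hand labels this is what keeps stray node names out of the match
  formula.\<close>

lemma set_lexp_simple_atoms: "simple_atoms l \<Longrightarrow> set_lexp l = {}"
proof (induction l)
  case (LAtom a)
  then show ?case
  proof (cases a)
    case (AInt i)
    with LAtom show ?thesis by (cases i) auto
  qed auto
qed auto

lemma fv_match_form:
  assumes "wf_rule r"
  shows "fv (match_form N r) \<subseteq> rule_fv r"
proof -
  have fin: "finite (nodes (lhs r))" "finite (edges (lhs r))"
    and ends: "src (lhs r) ` edges (lhs r) \<subseteq> nodes (lhs r)" "tgt (lhs r) ` edges (lhs r) \<subseteq> nodes (lhs r)"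
    using assms by (auto simp: wf_rule_def wf_graph_def)
  have lab: "fv_l (rule_term l) \<subseteq> rule_fv r" if "l \<in> rgraph_labels (lhs r)" for l
  proof -
    have "set_lexp l = {}"
      using assms that by (simp add: wf_rule_def simple_def set_lexp_simple_atoms)
    with that show ?thesis by (auto simp: rule_fv_def rgraph_vars_def)
  qed
  have cond: "fv (case rcond r of None \<Rightarrow> FTrue | Some c \<Rightarrow> rcond_form N c) \<subseteq> rule_fv r"
  proof (cases "rcond r")
    case (Some c)
    with assms have "rcond_vars c \<subseteq> rgraph_vars (lhs r)" "rcond_nodes c \<subseteq> nodes (lhs r)"
      by (auto simp: wf_rule_def)
    then show ?thesis
      using Some fv_rcond_form [of N c] by (simp add: rule_fv_def) blast
  qed simp
  have vars: "NodeV v \<in> rule_fv r" if "v \<in> nodes (lhs r)" for v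
    using that by (simp add: rule_fv_def)
  have evars: "EdgeV e \<in> rule_fv r" if "e \<in> edges (lhs r)" for e
    using that by (simp add: rule_fv_def)
  have nl: "fv_l (rule_term (nlabel (lhs r) v)) \<subseteq> rule_fv r" if "v \<in> nodes (lhs r)" for v
    using that by (intro lab) (simp add: rgraph_labels_def)
  have el: "fv_l (rule_term (elabel (lhs r) e)) \<subseteq> rule_fv r" if "e \<in> edges (lhs r)" for e
    using that by (intro lab) (simp add: rgraph_labels_def)
  show ?thesis
    unfolding match_form_def Let_def
    using fin ends cond vars evars nl [THEN subsetD] el [THEN subsetD]
    by (auto simp: image_subset_iff simp del: fv_rule_term split: if_splits)
qed

section \<open>Translating formulas along a rule application\<close>

text \<open>A variable of a formula over the result graph \<open>H\<close> denotes an item that was in the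
  host graph \<open>G\<close> outside the match, or an item of the right-hand graph. In the first
  case it is represented by the variable shifted by \<open>N\<close>, to keep it apart from the
  variables for the match. For an old edge we also record which of its end points are
  interface nodes (\<open>None\<close>: not in the match), because those are relabelled.\<close>

type_synonym node_env = "nat \<Rightarrow> nat option"

datatype edge_ref = OldEdge "nat option" "nat option" | NewEdge nat

type_synonym edge_env = "nat \<Rightarrow> edge_ref"

text \<open>The value of translating a node term: a term over \<open>G\<close> for a node outside
  the match, or an identifier of the right-hand graph, whose attributes in \<open>H\<close> can be
  read off the rule and the match.\<close>

datatype node_ref = OldNode nterm | NewNode nat

text \<open>Renaming keeps the type of a variable, and with it the domain of its quantifier. A
  formula over \<open>H\<close> is evaluated under
  \<open>\<alpha> \<circ> shift_var N\<close>.\<close>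

fun shift_var :: "nat \<Rightarrow> var \<Rightarrow> var" where
  "shift_var N (IntVar x) = IntVar (x + N)"
| "shift_var N (CharVar x) = CharVar (x + N)"
| "shift_var N (StrVar x) = StrVar (x + N)"
| "shift_var N (AtomVar x) = AtomVar (x + N)"
| "shift_var N (ListVar x) = ListVar (x + N)"

fun var_index :: "var \<Rightarrow> nat" where
  "var_index (IntVar x) = x"
| "var_index (CharVar x) = x"
| "var_index (StrVar x) = x"
| "var_index (AtomVar x) = x"
| "var_index (ListVar x) = x"

lemma var_index_shift_var [simp]: "var_index (shift_var N x) = var_index x + N"
  by (cases x) auto

lemma vdom_shift_var [simp]: "vdom (shift_var N x) = vdom x"
  by (cases x) auto

lemma vlength_shift_var [simp]: "vlength (shift_var N x) l = vlength x l"
  by (cases x; cases "(x, l)" rule: vlength.cases) auto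

lemma shift_var_eq_iff [simp]: "shift_var N x = shift_var N y \<longleftrightarrow> x = y"
  by (cases x; cases y) auto

fun shift_sexp :: "nat \<Rightarrow> sexp \<Rightarrow> sexp" where
  "shift_sexp N (SConst s) = SConst s"
| "shift_sexp N (CVar x) = CVar (x + N)"
| "shift_sexp N (SVar x) = SVar (x + N)"
| "shift_sexp N (SCat a b) = SCat (shift_sexp N a) (shift_sexp N b)"

lemma seval_shift_sexp [simp]: "seval \<alpha> (shift_sexp N s) = seval (\<alpha> \<circ> shift_var N) s"
  by (induction s) auto

lemma svars_shift_sexp [simp]: "svars (shift_sexp N s) = shift_var N ` svars s"
  by (induction s) auto

text \<open>One bound covers the node, edge and variable names of the left-hand graph. By
  well-formedness the condition and the right-hand labels use no other nodes and variables, so names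
  from \<open>N\<close> upwards are free for the translated formula.\<close>

locale shifted_rule =
  fixes r :: rule and N :: nat
  assumes wf_rule: "wf_rule r"
    and nodes_less: "\<And>v. v \<in> nodes (lhs r) \<Longrightarrow> v < N"
    and edges_less: "\<And>e. e \<in> edges (lhs r) \<Longrightarrow> e < N"
    and vars_less: "\<And>x. x \<in> rgraph_vars (lhs r) \<Longrightarrow> var_index x < N"
begin

abbreviation "L \<equiv> lhs r"
abbreviation "R \<equiv> rhs r"
abbreviation "K \<equiv> iface r"

lemma finite_rule [simp]:
  "finite (nodes L)" "finite (edges L)" "finite (nodes R)" "finite (edges R)" "finite K"
  using wf_rule by (auto simp: wf_rule_def wf_graph_def intro: finite_subset)

lemma iface_lhs: "v \<in> K \<Longrightarrow> v \<in> nodes L" and iface_rhs: "v \<in> K \<Longrightarrow> v \<in> nodes R"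
  using wf_rule by (auto simp: wf_rule_def)

lemma ends_lhs: "e \<in> edges L \<Longrightarrow> src L e \<in> nodes L" "e \<in> edges L \<Longrightarrow> tgt L e \<in> nodes L"
  and ends_rhs: "e \<in> edges R \<Longrightarrow> src R e \<in> nodes R" "e \<in> edges R \<Longrightarrow> tgt R e \<in> nodes R"
  using wf_rule by (auto simp: wf_rule_def wf_graph_def)

lemma rhs_label_vars:
  assumes "l \<in> rgraph_labels R"
  shows "lvars l \<subseteq> rgraph_vars L" "set_lexp l \<subseteq> nodes L"
  using wf_rule assms by (auto simp: wf_rule_def rgraph_vars_def)

lemma rhs_nlabel: "v \<in> nodes R \<Longrightarrow> nlabel R v \<in> rgraph_labels R"
  and rhs_elabel: "e \<in> edges R \<Longrightarrow> elabel R e \<in> rgraph_labels R"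
  by (auto simp: rgraph_labels_def)

lemma rhs_any_nmark: "v \<in> nodes R \<Longrightarrow> nmark R v = AnyMark \<Longrightarrow> v \<in> K"
  and rhs_any_emark: "e \<in> edges R \<Longrightarrow> emark R e = AnyMark \<Longrightarrow> e \<in> edges L"
  using wf_rule by (auto simp: wf_rule_def)

fun end_ref :: "nterm \<Rightarrow> nat option \<Rightarrow> node_ref" where
  "end_ref t None = OldNode t"
| "end_ref t (Some v) = NewNode v"

fun tr_n :: "node_env \<Rightarrow> edge_env \<Rightarrow> nterm \<Rightarrow> node_ref" where
  "tr_n \<sigma> \<tau> (NVar x) = end_ref (NVar (x + N)) (\<sigma> x)"
| "tr_n \<sigma> \<tau> (NSrc e) =
     (case \<tau> e of OldEdge s t \<Rightarrow> end_ref (NSrc (e + N)) s | NewEdge d \<Rightarrow> NewNode (src R d))"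
| "tr_n \<sigma> \<tau> (NTgt e) =
     (case \<tau> e of OldEdge s t \<Rightarrow> end_ref (NTgt (e + N)) t | NewEdge d \<Rightarrow> NewNode (tgt R d))"

text \<open>Nodes outside the match touch neither matched nor created edges and keep their degree. A
  created node has only edges of \<open>R\<close>. An interface node trades its edges in
  \<open>L\<close> for those in \<open>R\<close>; the resulting constant may be negative and is
  therefore an integer.\<close>

fun indeg_exp :: "node_ref \<Rightarrow> nterm iexp" where
  "indeg_exp (OldNode t) = Indeg t"
| "indeg_exp (NewNode v) =
     (if v \<in> K then Add (Indeg (NVar v)) (Num (int (indeg R v) - int (indeg L v)))
      else Num (int (indeg R v)))"

fun outdeg_exp :: "node_ref \<Rightarrow> nterm iexp" where
  "outdeg_exp (OldNode t) = Outdeg t"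
| "outdeg_exp (NewNode v) =
     (if v \<in> K then Add (Outdeg (NVar v)) (Num (int (outdeg R v) - int (outdeg L v)))
      else Num (int (outdeg R v)))"

fun tr_i :: "node_env \<Rightarrow> edge_env \<Rightarrow> nterm iexp \<Rightarrow> nterm iexp" where
  "tr_i \<sigma> \<tau> (Num i) = Num i"
| "tr_i \<sigma> \<tau> (IVar x) = IVar (x + N)"
| "tr_i \<sigma> \<tau> (Add a b) = Add (tr_i \<sigma> \<tau> a) (tr_i \<sigma> \<tau> b)"
| "tr_i \<sigma> \<tau> (Sub a b) = Sub (tr_i \<sigma> \<tau> a) (tr_i \<sigma> \<tau> b)"
| "tr_i \<sigma> \<tau> (Mul a b) = Mul (tr_i \<sigma> \<tau> a) (tr_i \<sigma> \<tau> b)"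
| "tr_i \<sigma> \<tau> (Div a b) = Div (tr_i \<sigma> \<tau> a) (tr_i \<sigma> \<tau> b)"
| "tr_i \<sigma> \<tau> (Indeg n) = indeg_exp (tr_n \<sigma> \<tau> n)"
| "tr_i \<sigma> \<tau> (Outdeg n) = outdeg_exp (tr_n \<sigma> \<tau> n)"
| "tr_i \<sigma> \<tau> (Length x) = Length (shift_var N x)"

fun tr_a :: "node_env \<Rightarrow> edge_env \<Rightarrow> nterm aexp \<Rightarrow> nterm aexp" where
  "tr_a \<sigma> \<tau> (AInt a) = AInt (tr_i \<sigma> \<tau> a)"
| "tr_a \<sigma> \<tau> (AStr s) = AStr (shift_sexp N s)"
| "tr_a \<sigma> \<tau> (AVar x) = AVar (x + N)"

text \<open>Labels of \<open>R\<close> are inserted without translation: rule application evaluates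
  their expressions, degrees included, in \<open>G\<close> under the match and not in
  \<open>H\<close>.\<close>

fun tr_l :: "node_env \<Rightarrow> edge_env \<Rightarrow> lterm \<Rightarrow> lterm" where
  "tr_l \<sigma> \<tau> TEmpty = TEmpty"
| "tr_l \<sigma> \<tau> (TAtom a) = TAtom (tr_a \<sigma> \<tau> a)"
| "tr_l \<sigma> \<tau> (TVar x) = TVar (x + N)"
| "tr_l \<sigma> \<tau> (TConc s t) = TConc (tr_l \<sigma> \<tau> s) (tr_l \<sigma> \<tau> t)"
| "tr_l \<sigma> \<tau> (TLabV n) =
     (case tr_n \<sigma> \<tau> n of OldNode t \<Rightarrow> TLabV t | NewNode v \<Rightarrow> rule_term (nlabel R v))"
| "tr_l \<sigma> \<tau> (TLabE e) =
     (case \<tau> e of OldEdge _ _ \<Rightarrow> TLabE (e + N) | NewEdge d \<Rightarrow> rule_term (elabel R d))"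

text \<open>A right-hand node marked \<open>AnyMark\<close> is an interface node that keeps its old
  mark, so the mark is read in \<open>G\<close> at the rule variable of the same name.
  \<open>tr_em\<close> does the same for edges.\<close>

fun tr_nm :: "node_env \<Rightarrow> edge_env \<Rightarrow> nmterm \<Rightarrow> nmterm" where
  "tr_nm \<sigma> \<tau> (NMConst m) = NMConst m"
| "tr_nm \<sigma> \<tau> (NMark n) =
     (case tr_n \<sigma> \<tau> n of OldNode t \<Rightarrow> NMark t
      | NewNode v \<Rightarrow> (case nmark R v of Mark m \<Rightarrow> NMConst m | AnyMark \<Rightarrow> NMark (NVar v)))"

fun tr_em :: "edge_env \<Rightarrow> emterm \<Rightarrow> emterm" where
  "tr_em \<tau> (EMConst m) = EMConst m"
| "tr_em \<tau> (EMark e) =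
     (case \<tau> e of OldEdge _ _ \<Rightarrow> EMark (e + N)
      | NewEdge d \<Rightarrow> (case emark R d of Mark m \<Rightarrow> EMConst m | AnyMark \<Rightarrow> EMark d))"

text \<open>Mixed pairs are unequal: images of right-hand nodes are either images of interface
  nodes, hence inside the match, or fresh.\<close>

fun eq_nodes :: "node_ref \<Rightarrow> node_ref \<Rightarrow> form" where
  "eq_nodes (OldNode s) (OldNode t) = FEqN s t"
| "eq_nodes (NewNode u) (NewNode v) = fbool (u = v)"
| "eq_nodes _ _ = FFalse"

fun eq_edges :: "edge_env \<Rightarrow> nat \<Rightarrow> nat \<Rightarrow> form" where
  "eq_edges \<tau> d e =
     (case (\<tau> d, \<tau> e) of
        (OldEdge _ _, OldEdge _ _) \<Rightarrow> FEqE (d + N) (e + N)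
      | (NewEdge d', NewEdge e') \<Rightarrow> fbool (d' = e')
      | _ \<Rightarrow> FFalse)"

fun node_is :: "nterm \<Rightarrow> nat option \<Rightarrow> form" where
  "node_is t None = FConj (nodes L) (\<lambda>v. FNot (FEqN t (NVar v)))"
| "node_is t (Some v) = FEqN t (NVar v)"

text \<open>The possible kinds of end point of an unmatched edge. By the dangling condition such an
  edge never ends at a deleted node, so apart from nodes outside the match only interface nodes
  remain.\<close>

definition end_refs :: "nat option set" where
  "end_refs = insert None (Some ` K)"

lemma finite_end_refs [simp]: "finite end_refs"
  by (simp add: end_refs_def)

text \<open>For an old edge the translation guesses the kind of each end point and checks the guess
  with \<open>node_is\<close>. This has to happen at the quantifier, since the translation of source
  and target terms below it depends on the guess.\<close>

fun tr :: "node_env \<Rightarrow> edge_env \<Rightarrow> form \<Rightarrow> form" where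
  "tr \<sigma> \<tau> FTrue = FTrue"
| "tr \<sigma> \<tau> FFalse = FFalse"
| "tr \<sigma> \<tau> (FInt t) = FInt (tr_l \<sigma> \<tau> t)"
| "tr \<sigma> \<tau> (FChar t) = FChar (tr_l \<sigma> \<tau> t)"
| "tr \<sigma> \<tau> (FString t) = FString (tr_l \<sigma> \<tau> t)"
| "tr \<sigma> \<tau> (FAtom t) = FAtom (tr_l \<sigma> \<tau> t)"
| "tr \<sigma> \<tau> (FRoot n) =
     (case tr_n \<sigma> \<tau> n of OldNode t \<Rightarrow> FRoot t | NewNode v \<Rightarrow> fbool (rooted R v))"
| "tr \<sigma> \<tau> (FEqL s t) = FEqL (tr_l \<sigma> \<tau> s) (tr_l \<sigma> \<tau> t)"
| "tr \<sigma> \<tau> (FRel q a b) = FRel q (tr_i \<sigma> \<tau> a) (tr_i \<sigma> \<tau> b)"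
| "tr \<sigma> \<tau> (FEqN m n) = eq_nodes (tr_n \<sigma> \<tau> m) (tr_n \<sigma> \<tau> n)"
| "tr \<sigma> \<tau> (FEqE d e) = eq_edges \<tau> d e"
| "tr \<sigma> \<tau> (FEqNM s t) = FEqNM (tr_nm \<sigma> \<tau> s) (tr_nm \<sigma> \<tau> t)"
| "tr \<sigma> \<tau> (FEqEM s t) = FEqEM (tr_em \<tau> s) (tr_em \<tau> t)"
| "tr \<sigma> \<tau> (FNot c) = FNot (tr \<sigma> \<tau> c)"
| "tr \<sigma> \<tau> (FAnd c d) = FAnd (tr \<sigma> \<tau> c) (tr \<sigma> \<tau> d)"
| "tr \<sigma> \<tau> (FOr c d) = FOr (tr \<sigma> \<tau> c) (tr \<sigma> \<tau> d)"
| "tr \<sigma> \<tau> (FExV x c) =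
     FOr (FExV (x + N) (FAnd (node_is (NVar (x + N)) None) (tr (\<sigma>(x := None)) \<tau> c)))
       (FDisj (nodes R) (\<lambda>v. tr (\<sigma>(x := Some v)) \<tau> c))"
| "tr \<sigma> \<tau> (FExE x c) =
     FOr (FExE (x + N) (FAnd (FConj (edges L) (\<lambda>e. FNot (FEqE (x + N) e)))
         (FDisj end_refs (\<lambda>s. FDisj end_refs (\<lambda>t.
            FAnd (FAnd (node_is (NSrc (x + N)) s) (node_is (NTgt (x + N)) t))
              (tr \<sigma> (\<tau>(x := OldEdge s t)) c))))))
       (FDisj (edges R) (\<lambda>e. tr \<sigma> (\<tau>(x := NewEdge e)) c))"
| "tr \<sigma> \<tau> (FExL x c) = FExL (shift_var N x) (tr \<sigma> \<tau> c)"

definition valid_env :: "node_env \<Rightarrow> edge_env \<Rightarrow> bool" where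
  "valid_env \<sigma> \<tau> \<longleftrightarrow> (\<forall>x v. \<sigma> x = Some v \<longrightarrow> v \<in> nodes R) \<and>
     (\<forall>x s t. \<tau> x = OldEdge s t \<longrightarrow> s \<in> end_refs \<and> t \<in> end_refs) \<and>
     (\<forall>x e. \<tau> x = NewEdge e \<longrightarrow> e \<in> edges R)"

lemma valid_env_OldEdge:
  "valid_env \<sigma> \<tau> \<Longrightarrow> \<tau> x = OldEdge s t \<Longrightarrow> s \<in> end_refs \<and> t \<in> end_refs"
  by (auto simp: valid_env_def)

lemma valid_env_NewEdge: "valid_env \<sigma> \<tau> \<Longrightarrow> \<tau> x = NewEdge e \<Longrightarrow> e \<in> edges R"
  by (auto simp: valid_env_def)

lemma valid_env_node: "valid_env \<sigma> \<tau> \<Longrightarrow> \<sigma> x = Some v \<Longrightarrow> v \<in> nodes R"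
  by (auto simp: valid_env_def)

lemma valid_env_upd [simp]:
  "valid_env \<sigma> \<tau> \<Longrightarrow> valid_env (\<sigma>(x := None)) \<tau>"
  "valid_env \<sigma> \<tau> \<Longrightarrow> v \<in> nodes R \<Longrightarrow> valid_env (\<sigma>(x := Some v)) \<tau>"
  "valid_env \<sigma> \<tau> \<Longrightarrow> s \<in> end_refs \<Longrightarrow> t \<in> end_refs \<Longrightarrow> valid_env \<sigma> (\<tau>(x := OldEdge s t))"
  "valid_env \<sigma> \<tau> \<Longrightarrow> e \<in> edges R \<Longrightarrow> valid_env \<sigma> (\<tau>(x := NewEdge e))"
  by (auto simp: valid_env_def)

lemma tr_n_NewNode: "valid_env \<sigma> \<tau> \<Longrightarrow> tr_n \<sigma> \<tau> n = NewNode v \<Longrightarrow> v \<in> nodes R"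
proof -
  assume *: "valid_env \<sigma> \<tau>" "tr_n \<sigma> \<tau> n = NewNode v"
  have end_ref: "u = Some v" if "end_ref t u = NewNode v" for t u
    using that by (cases u) auto
  have "v \<in> nodes R" if "Some v \<in> end_refs" using that iface_rhs by (auto simp: end_refs_def)
  with * show ?thesis
    by (cases n) (auto split: edge_ref.splits dest!: end_ref
        dest: valid_env_OldEdge valid_env_NewEdge valid_env_node intro: ends_rhs)
qed

subsection \<open>Free variables of the translation\<close>

fun tr_fvar :: "node_env \<Rightarrow> edge_env \<Rightarrow> fvar \<Rightarrow> fvar set" where
  "tr_fvar \<sigma> \<tau> (NodeV x) = (if \<sigma> x = None then {NodeV (x + N)} else {})"
| "tr_fvar \<sigma> \<tau> (EdgeV x) = (case \<tau> x of OldEdge _ _ \<Rightarrow> {EdgeV (x + N)} | NewEdge _ \<Rightarrow> {})"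
| "tr_fvar \<sigma> \<tau> (LabelV x) = {LabelV (shift_var N x)}"

text \<open>A variable sent to a right-hand item disappears from the formula. In exchange variables
  of the rule may appear, because the attributes of that item are expressed through the
  match.\<close>

definition tr_fvars :: "node_env \<Rightarrow> edge_env \<Rightarrow> fvar set \<Rightarrow> fvar set" where
  "tr_fvars \<sigma> \<tau> F = rule_fv r \<union> (\<Union>y \<in> F. tr_fvar \<sigma> \<tau> y)"

lemma tr_fvars_simps [simp]:
  "tr_fvars \<sigma> \<tau> (F \<union> F') = tr_fvars \<sigma> \<tau> F \<union> tr_fvars \<sigma> \<tau> F'"
  "tr_fvars \<sigma> \<tau> (insert y F) = tr_fvar \<sigma> \<tau> y \<union> tr_fvars \<sigma> \<tau> F"
  "tr_fvars \<sigma> \<tau> {} = rule_fv r"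
  by (auto simp: tr_fvars_def)

lemma NodeV_rule_fv [simp]: "NodeV v \<in> rule_fv r \<longleftrightarrow> v \<in> nodes L"
  and EdgeV_rule_fv [simp]: "EdgeV e \<in> rule_fv r \<longleftrightarrow> e \<in> edges L"
  by (auto simp: rule_fv_def)

lemma rule_fv_subset: "rule_fv r \<subseteq> tr_fvars \<sigma> \<tau> F"
  by (auto simp: tr_fvars_def)

lemma fv_rhs_label:
  "v \<in> nodes R \<Longrightarrow> fv_l (rule_term (nlabel R v)) \<subseteq> rule_fv r"
  "e \<in> edges R \<Longrightarrow> fv_l (rule_term (elabel R e)) \<subseteq> rule_fv r"
proof -
  have "fv_l (rule_term l) \<subseteq> rule_fv r" if "l \<in> rgraph_labels R" for l
    using rhs_label_vars [OF that] by (simp add: rule_fv_def) blast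
  then show "v \<in> nodes R \<Longrightarrow> fv_l (rule_term (nlabel R v)) \<subseteq> rule_fv r"
    and "e \<in> edges R \<Longrightarrow> fv_l (rule_term (elabel R e)) \<subseteq> rule_fv r"
    by (blast intro: rhs_nlabel rhs_elabel)+
qed

lemma tr_n_OldNode: "tr_n \<sigma> \<tau> n = OldNode t \<Longrightarrow> fv_n t \<subseteq> tr_fvars \<sigma> \<tau> (fv_n n)"
proof -
  have end_ref: "u = None \<and> t = t'" if "end_ref t' u = OldNode t" for t' u
    using that by (cases u) auto
  show "tr_n \<sigma> \<tau> n = OldNode t \<Longrightarrow> fv_n t \<subseteq> tr_fvars \<sigma> \<tau> (fv_n n)"
    by (cases n) (auto split: edge_ref.splits dest!: end_ref)
qed

lemma fv_tr_i: "valid_env \<sigma> \<tau> \<Longrightarrow> fv_i (tr_i \<sigma> \<tau> a) \<subseteq> tr_fvars \<sigma> \<tau> (fv_i a)"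
proof (induction a)
  case (Indeg n)
  show ?case
  proof (cases "tr_n \<sigma> \<tau> n")
    case (OldNode t)
    then show ?thesis using tr_n_OldNode by simp
  next
    case (NewNode v)
    then show ?thesis by (auto simp: iface_lhs intro: rule_fv_subset [THEN subsetD])
  qed
next
  case (Outdeg n)
  show ?case
  proof (cases "tr_n \<sigma> \<tau> n")
    case (OldNode t)
    then show ?thesis using tr_n_OldNode by simp
  next
    case (NewNode v)
    then show ?thesis by (auto simp: iface_lhs intro: rule_fv_subset [THEN subsetD])
  qed
qed auto

lemma fv_tr_l: "valid_env \<sigma> \<tau> \<Longrightarrow> fv_l (tr_l \<sigma> \<tau> t) \<subseteq> tr_fvars \<sigma> \<tau> (fv_l t)"
proof (induction t)
  case (TAtom a)
  then show ?case
    using fv_tr_i by (cases a) (auto simp: tr_fvars_def)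
next
  case (TLabV n)
  show ?case
  proof (cases "tr_n \<sigma> \<tau> n")
    case (OldNode t)
    then show ?thesis using tr_n_OldNode by simp
  next
    case (NewNode v)
    with TLabV have "v \<in> nodes R" by (simp add: tr_n_NewNode)
    then show ?thesis
      using NewNode fv_rhs_label rule_fv_subset by (simp del: fv_rule_term) blast
  qed
next
  case (TLabE e)
  show ?case
  proof (cases "\<tau> e")
    case (OldEdge s t)
    then show ?thesis by simp
  next
    case (NewEdge d)
    with TLabE have "d \<in> edges R" by (simp add: valid_env_NewEdge)
    then show ?thesis using NewEdge fv_rhs_label by (simp del: fv_rule_term)
  qed
qed auto

lemma fv_tr_nm: "valid_env \<sigma> \<tau> \<Longrightarrow> fv_nm (tr_nm \<sigma> \<tau> t) \<subseteq> tr_fvars \<sigma> \<tau> (fv_nm t)"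
proof (induction t)
  case (NMark n)
  show ?case
  proof (cases "tr_n \<sigma> \<tau> n")
    case (OldNode t)
    then show ?thesis using tr_n_OldNode by simp
  next
    case (NewNode v)
    with NMark have "v \<in> nodes R" by (simp add: tr_n_NewNode)
    then show ?thesis
      using NewNode rhs_any_nmark rule_fv_subset [THEN subsetD, of "NodeV v"]
      by (auto simp: iface_lhs split: rmark.splits)
  qed
qed simp

lemma fv_tr_em: "valid_env \<sigma> \<tau> \<Longrightarrow> fv_em (tr_em \<tau> t) \<subseteq> tr_fvars \<sigma> \<tau> (fv_em t)"
  by (cases t) (auto split: edge_ref.splits rmark.splits simp: valid_env_NewEdge rhs_any_emark)

lemma fv_node_is: "u \<in> end_refs \<Longrightarrow> fv (node_is t u) \<subseteq> fv_n t \<union> rule_fv r"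
  by (cases u) (auto simp: end_refs_def iface_lhs)

text \<open>For closed \<open>c\<close> only variables of the rule remain, and these are bound by
  the quantifier blocks that range over matches.\<close>

lemma fv_tr: "valid_env \<sigma> \<tau> \<Longrightarrow> fv (tr \<sigma> \<tau> c) \<subseteq> tr_fvars \<sigma> \<tau> (fv c)"
proof (induction c arbitrary: \<sigma> \<tau>)
  case (FRoot n)
  show ?case using tr_n_OldNode by (auto split: node_ref.splits)
next
  case (FEqN m n)
  show ?case
    using tr_n_OldNode [of \<sigma> \<tau> m] tr_n_OldNode [of \<sigma> \<tau> n]
    by (cases "tr_n \<sigma> \<tau> m"; cases "tr_n \<sigma> \<tau> n") auto
next
  case (FEqE d e)
  show ?case by (auto split: edge_ref.splits)
next
  case (FExV x c)
  have old: "tr_fvars (\<sigma>(x := None)) \<tau> (fv c) - {NodeV (x + N)} \<subseteq> tr_fvars \<sigma> \<tau> (fv c - {NodeV x})"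
    and new: "tr_fvars (\<sigma>(x := Some v)) \<tau> (fv c) \<subseteq> tr_fvars \<sigma> \<tau> (fv c - {NodeV x})" for v
  proof -
    \<comment> \<open>Changing \<open>\<sigma>\<close> at \<open>x\<close> affects the contribution
      of \<open>NodeV x\<close> only. That contribution is the shifted variable, which the new
      quantifier binds, or nothing.\<close>
    have *: "tr_fvars (\<sigma>(x := u)) \<tau> (fv c) \<subseteq>
        tr_fvars \<sigma> \<tau> (fv c - {NodeV x}) \<union> tr_fvar (\<sigma>(x := u)) \<tau> (NodeV x)" for u
    proof
      fix z assume "z \<in> tr_fvars (\<sigma>(x := u)) \<tau> (fv c)"
      then consider "z \<in> rule_fv r" | y where "y \<in> fv c" "z \<in> tr_fvar (\<sigma>(x := u)) \<tau> y"
        by (auto simp: tr_fvars_def)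
      then show "z \<in> tr_fvars \<sigma> \<tau> (fv c - {NodeV x}) \<union> tr_fvar (\<sigma>(x := u)) \<tau> (NodeV x)"
      proof cases
        case 2
        have "tr_fvar (\<sigma>(x := u)) \<tau> y = tr_fvar \<sigma> \<tau> y" if "y \<noteq> NodeV x"
          using that by (cases y) auto
        with 2 show ?thesis by (cases "y = NodeV x") (auto simp: tr_fvars_def)
      qed (auto simp: tr_fvars_def)
    qed
    show "tr_fvars (\<sigma>(x := None)) \<tau> (fv c) - {NodeV (x + N)} \<subseteq> tr_fvars \<sigma> \<tau> (fv c - {NodeV x})"
      using * [of None] by auto
    show "tr_fvars (\<sigma>(x := Some v)) \<tau> (fv c) \<subseteq> tr_fvars \<sigma> \<tau> (fv c - {NodeV x})"
      using * [of "Some v"] by auto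
  qed
  have "fv (tr (\<sigma>(x := None)) \<tau> c) \<subseteq> tr_fvars (\<sigma>(x := None)) \<tau> (fv c)"
    "\<And>v. v \<in> nodes R \<Longrightarrow> fv (tr (\<sigma>(x := Some v)) \<tau> c) \<subseteq> tr_fvars (\<sigma>(x := Some v)) \<tau> (fv c)"
    by (intro FExV.IH valid_env_upd FExV.prems; assumption)+
  moreover have "fv (node_is (NVar (x + N)) None) - {NodeV (x + N)} \<subseteq> rule_fv r"
    by auto
  ultimately show ?case
    using old new rule_fv_subset [of \<sigma> \<tau> "fv c - {NodeV x}"]
    by (simp del: node_is.simps) blast
next
  case (FExE x c)
  have old: "tr_fvars \<sigma> (\<tau>(x := OldEdge s t)) (fv c) - {EdgeV (x + N)} \<subseteq> tr_fvars \<sigma> \<tau> (fv c - {EdgeV x})"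
    and new: "tr_fvars \<sigma> (\<tau>(x := NewEdge e)) (fv c) \<subseteq> tr_fvars \<sigma> \<tau> (fv c - {EdgeV x})" for s t e
  proof -
    have *: "tr_fvars \<sigma> (\<tau>(x := u)) (fv c) \<subseteq>
        tr_fvars \<sigma> \<tau> (fv c - {EdgeV x}) \<union> tr_fvar \<sigma> (\<tau>(x := u)) (EdgeV x)" for u
    proof
      fix z assume "z \<in> tr_fvars \<sigma> (\<tau>(x := u)) (fv c)"
      then consider "z \<in> rule_fv r" | y where "y \<in> fv c" "z \<in> tr_fvar \<sigma> (\<tau>(x := u)) y"
        by (auto simp: tr_fvars_def)
      then show "z \<in> tr_fvars \<sigma> \<tau> (fv c - {EdgeV x}) \<union> tr_fvar \<sigma> (\<tau>(x := u)) (EdgeV x)"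
      proof cases
        case 2
        have "tr_fvar \<sigma> (\<tau>(x := u)) y = tr_fvar \<sigma> \<tau> y" if "y \<noteq> EdgeV x"
          using that by (cases y) auto
        with 2 show ?thesis by (cases "y = EdgeV x") (auto simp: tr_fvars_def)
      qed (auto simp: tr_fvars_def)
    qed
    show "tr_fvars \<sigma> (\<tau>(x := OldEdge s t)) (fv c) - {EdgeV (x + N)} \<subseteq> tr_fvars \<sigma> \<tau> (fv c - {EdgeV x})"
      using * [of "OldEdge s t"] by auto
    show "tr_fvars \<sigma> (\<tau>(x := NewEdge e)) (fv c) \<subseteq> tr_fvars \<sigma> \<tau> (fv c - {EdgeV x})"
      using * [of "NewEdge e"] by auto
  qed
  let ?F = "tr_fvars \<sigma> \<tau> (fv c - {EdgeV x})"
  have "fv (tr \<sigma> (\<tau>(x := OldEdge s t)) c) \<subseteq> tr_fvars \<sigma> (\<tau>(x := OldEdge s t)) (fv c)"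
    if "s \<in> end_refs" "t \<in> end_refs" for s t
    by (intro FExE.IH valid_env_upd FExE.prems that)
  with old have body_old: "fv (tr \<sigma> (\<tau>(x := OldEdge s t)) c) \<subseteq> insert (EdgeV (x + N)) ?F"
    if "s \<in> end_refs" "t \<in> end_refs" for s t
    using that by blast
  have "fv (tr \<sigma> (\<tau>(x := NewEdge e)) c) \<subseteq> tr_fvars \<sigma> (\<tau>(x := NewEdge e)) (fv c)"
    if "e \<in> edges R" for e
    by (intro FExE.IH valid_env_upd FExE.prems that)
  with new have body_new: "fv (tr \<sigma> (\<tau>(x := NewEdge e)) c) \<subseteq> ?F" if "e \<in> edges R" for e
    using that by blast
  have ends: "fv (node_is (NSrc (x + N)) u) \<subseteq> insert (EdgeV (x + N)) ?F"
    "fv (node_is (NTgt (x + N)) u) \<subseteq> insert (EdgeV (x + N)) ?F" if "u \<in> end_refs" for u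
    using fv_node_is [OF that, of "NSrc (x + N)"] fv_node_is [OF that, of "NTgt (x + N)"]
      rule_fv_subset [of \<sigma> \<tau> "fv c - {EdgeV x}"] by auto
  have "EdgeV e \<in> ?F" if "e \<in> edges L" for e
    using that by (intro rule_fv_subset [THEN subsetD]) simp
  then show ?case
    by (auto simp del: node_is.simps split: if_splits
        dest: body_old [THEN subsetD, rotated 2] body_new [THEN subsetD, rotated 1]
          ends(1) [THEN subsetD, rotated 1] ends(2) [THEN subsetD, rotated 1])
next
  case (FExL x c)
  then have "fv (tr \<sigma> \<tau> c) \<subseteq> tr_fvars \<sigma> \<tau> (fv c)" by simp
  moreover have "tr_fvars \<sigma> \<tau> (fv c) - {LabelV (shift_var N x)} \<subseteq> tr_fvars \<sigma> \<tau> (fv c - {LabelV x})"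
    by (fastforce simp: tr_fvars_def)
  ultimately show ?case by auto
qed (simp_all add: fv_tr_l fv_tr_i fv_tr_nm fv_tr_em le_supI1 le_supI2)

end

subsection \<open>Truth of the translation\<close>

locale derivation = shifted_rule +
  fixes G H :: host and gV gE hV hE :: "nat \<Rightarrow> nat" and \<alpha>0 :: assignment
  assumes host: "host_graph G"
    and match: "is_match r G gV gE \<alpha>0"
    and result: "is_result r G gV gE \<alpha>0 hV hE H"
begin

section \<open>Structure of the result graph: untouched items and right-hand items\<close>

abbreviation "old_nodes \<equiv> nodes G - gV ` nodes L"
abbreviation "old_edges \<equiv> edges G - gE ` edges L"

lemma match_facts:
  shows inj_gV: "inj_on gV (nodes L)"
    and inj_gE: "inj_on gE (edges L)" and gE_in: "e \<in> edges L \<Longrightarrow> gE e \<in> edges G"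
    and gE_src: "e \<in> edges L \<Longrightarrow> src G (gE e) = gV (src L e)"
    and gE_tgt: "e \<in> edges L \<Longrightarrow> tgt G (gE e) = gV (tgt L e)"
    and dangling: "e \<in> old_edges \<Longrightarrow> src G e \<notin> gV ` (nodes L - K)"
      "e \<in> old_edges \<Longrightarrow> tgt G e \<notin> gV ` (nodes L - K)"
  using match by (simp_all add: is_match_def Let_def image_subset_iff)

lemma result_facts:
  shows inj_hV: "inj_on hV (nodes R)" and hV_iface: "v \<in> K \<Longrightarrow> hV v = gV v"
    and hV_fresh: "v \<in> nodes R \<Longrightarrow> v \<notin> K \<Longrightarrow> hV v \<notin> nodes G"
    and inj_hE: "inj_on hE (edges R)" and hE_fresh: "e \<in> edges R \<Longrightarrow> hE e \<notin> edges G"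
    and nodes_H': "nodes H = (nodes G - gV ` (nodes L - K)) \<union> hV ` nodes R"
    and edges_H: "edges H = old_edges \<union> hE ` edges R"
    and old_node_attrs: "v \<in> old_nodes \<Longrightarrow>
      nlabel H v = nlabel G v \<and> nmark H v = nmark G v \<and> rooted H v = rooted G v"
    and new_node_attrs: "v \<in> nodes R \<Longrightarrow>
      nlabel H (hV v) = rleval G gV \<alpha>0 (nlabel R v) \<and>
      nmark H (hV v) = new_mark (nmark G (gV v)) (nmark R v) \<and> rooted H (hV v) = rooted R v"
    and old_edge_attrs: "e \<in> old_edges \<Longrightarrow>
      src H e = src G e \<and> tgt H e = tgt G e \<and> elabel H e = elabel G e \<and> emark H e = emark G e"
    and new_edge_attrs: "e \<in> edges R \<Longrightarrow>
      src H (hE e) = hV (src R e) \<and> tgt H (hE e) = hV (tgt R e) \<and>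
      elabel H (hE e) = rleval G gV \<alpha>0 (elabel R e) \<and>
      emark H (hE e) = new_mark (emark G (gE e)) (emark R e)"
  using result by (simp_all add: is_result_def Let_def disjoint_iff)

lemma host_ends: "e \<in> edges G \<Longrightarrow> src G e \<in> nodes G" "e \<in> edges G \<Longrightarrow> tgt G e \<in> nodes G"
  and host_finite [simp]: "finite (nodes G)" "finite (edges G)"
  using host by (auto simp: wf_graph_def)

lemma hV_not_old: "v \<in> nodes R \<Longrightarrow> hV v \<notin> old_nodes"
  using hV_fresh [of v] hV_iface [of v] iface_lhs [of v] by (cases "v \<in> K") auto

text \<open>Interface nodes are moved to the right-hand side of the union, since there
  \<open>hV\<close> agrees with \<open>gV\<close>. The regrouped union mirrors the two disjuncts of
  a translated node quantifier.\<close>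

lemma nodes_H: "nodes H = old_nodes \<union> hV ` nodes R"
proof -
  have "gV v \<in> hV ` nodes R" if "v \<in> K" for v
    using hV_iface [OF that] iface_rhs [OF that] by (metis imageI)
  then show ?thesis unfolding nodes_H' by blast
qed

lemma old_edge_end:
  assumes "e \<in> old_edges"
  shows "src G e \<in> old_nodes \<or> (\<exists>v \<in> K. src G e = gV v)"
    and "tgt G e \<in> old_nodes \<or> (\<exists>v \<in> K. tgt G e = gV v)"
  using assms host_ends [of e] dangling [OF assms] by blast+

lemma hE_not_old: "e \<in> edges R \<Longrightarrow> hE e \<notin> old_edges"
  using hE_fresh by blast

text \<open>Required because \<open>expressible\<close> guarantees the meaning of a formula on
  well-formed graphs only, and the original formula is evaluated in \<open>H\<close>.\<close>

lemma host_result: "host_graph H"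
proof -
  have "src H e \<in> nodes H \<and> tgt H e \<in> nodes H" if "e \<in> edges H" for e
  proof (cases "e \<in> old_edges")
    case True
    have "gV v \<in> nodes H" if "v \<in> K" for v
      using hV_iface [OF that] iface_rhs [OF that] nodes_H by (metis UnI2 imageI)
    moreover have "v \<in> nodes H" if "v \<in> old_nodes" for v
      using that nodes_H by blast
    ultimately show ?thesis
      using old_edge_end [OF True] old_edge_attrs [OF True] by metis
  next
    case False
    with that obtain d where "d \<in> edges R" "e = hE d" using edges_H by auto
    then show ?thesis using new_edge_attrs ends_rhs nodes_H by auto
  qed
  then show ?thesis using nodes_H edges_H by (auto simp: wf_graph_def)
qed

text \<open>Abstract in the end-point functions, so that indegree and outdegree are two instances.
  The edges of \<open>H\<close> at a node split into old and created ones: created edges end at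
  images of \<open>hV\<close> only, and no old edge ends at a fresh node.\<close>

lemma degree:
  fixes tG tH tL tR :: "nat \<Rightarrow> nat"
  assumes tL: "\<And>e. e \<in> edges L \<Longrightarrow> tL e \<in> nodes L \<and> tG (gE e) = gV (tL e)"
    and tR: "\<And>e. e \<in> edges R \<Longrightarrow> tR e \<in> nodes R \<and> tH (hE e) = hV (tR e)"
    and tG: "\<And>e. e \<in> old_edges \<Longrightarrow> tH e = tG e \<and> tG e \<in> nodes G"
  defines "degG \<equiv> \<lambda>v. card {e \<in> edges G. tG e = v}" and "degH \<equiv> \<lambda>v. card {e \<in> edges H. tH e = v}"
    and "degL \<equiv> \<lambda>v. card {e \<in> edges L. tL e = v}" and "degR \<equiv> \<lambda>v. card {e \<in> edges R. tR e = v}"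
  shows "v \<in> old_nodes \<Longrightarrow> degH v = degG v"
    and "v \<in> nodes R \<Longrightarrow> v \<notin> K \<Longrightarrow> degH (hV v) = degR v"
    and "v \<in> K \<Longrightarrow> int (degH (hV v)) = int (degG (gV v)) + (int (degR v) - int (degL v))"
proof -
  have new: "{e \<in> hE ` edges R. tH e = hV v} = hE ` {e \<in> edges R. tR e = v}" if "v \<in> nodes R" for v
    using tR inj_on_eq_iff [OF inj_hV _ that] by auto
  have card_new: "card (hE ` {e \<in> edges R. tR e = v}) = degR v" for v
    unfolding degR_def by (rule card_image) (rule inj_on_subset [OF inj_hE], auto)
  have split: "{e \<in> edges H. tH e = v} = {e \<in> old_edges. tG e = v} \<union> {e \<in> hE ` edges R. tH e = v}" for v
    using tG by (auto simp: edges_H)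
  {
    assume v: "v \<in> old_nodes"
    have "{e \<in> hE ` edges R. tH e = v} = {}" using v tR hV_not_old by auto
    moreover have "{e \<in> old_edges. tG e = v} = {e \<in> edges G. tG e = v}" using v tL by auto
    ultimately show "degH v = degG v" by (simp only: degG_def degH_def split Un_empty_right)
  next
    assume v: "v \<in> nodes R" "v \<notin> K"
    have old: "{e \<in> old_edges. tG e = hV v} = {}" using tG hV_fresh [OF v] by force
    show "degH (hV v) = degR v"
      unfolding degH_def split new [OF v(1)] old by (simp only: Un_empty_left card_new)
  next
    assume v: "v \<in> K"
    let ?m = "gE ` {e \<in> edges L. tL e = v}"
    \<comment> \<open>Since \<open>gV\<close> is injective, a matched edge ends at
      \<open>gV v\<close> exactly if its preimage ends at \<open>v\<close>; \<open>?m\<close> thus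
      collects all deleted edges at this node.\<close>
    have old: "{e \<in> old_edges. tG e = hV v} = {e \<in> edges G. tG e = gV v} - ?m"
      using tL inj_on_eq_iff [OF inj_gV _ iface_lhs [OF v]] by (auto simp: hV_iface [OF v])
    have sub: "?m \<subseteq> {e \<in> edges G. tG e = gV v}" using tL gE_in by auto
    have "card ?m = degL v"
      unfolding degL_def by (rule card_image) (rule inj_on_subset [OF inj_gE], auto)
    then have "card {e \<in> old_edges. tG e = hV v} = degG (gV v) - degL v"
      using sub unfolding old degG_def by (simp add: card_Diff_subset)
    \<comment> \<open>The edges of \<open>L\<close> at \<open>v\<close> embed into those of
      \<open>G\<close> at \<open>gV v\<close>, so the natural subtraction loses nothing.\<close>
    moreover have le: "degL v \<le> degG (gV v)"
      using card_mono [OF _ sub] \<open>card ?m = degL v\<close> by (simp add: degG_def)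
    moreover have "card {e \<in> edges H. tH e = hV v} = card {e \<in> old_edges. tG e = hV v} + degR v"
      unfolding split new [OF iface_rhs [OF v]] card_new [symmetric]
      by (rule card_Un_disjoint) (use hE_fresh in auto)
    ultimately show "int (degH (hV v)) = int (degG (gV v)) + (int (degR v) - int (degL v))"
      unfolding degH_def using le by (simp add: of_nat_diff)
  }
qed

lemma indeg_H:
  shows "v \<in> old_nodes \<Longrightarrow> indeg H v = indeg G v"
    and "v \<in> nodes R \<Longrightarrow> v \<notin> K \<Longrightarrow> indeg H (hV v) = indeg R v"
    and "v \<in> K \<Longrightarrow> int (indeg H (hV v)) = int (indeg G (gV v)) + (int (indeg R v) - int (indeg L v))"
proof -
  have 1: "tgt L e \<in> nodes L \<and> tgt G (gE e) = gV (tgt L e)" if "e \<in> edges L" for e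
    using that by (simp add: ends_lhs gE_tgt)
  have 2: "tgt R e \<in> nodes R \<and> tgt H (hE e) = hV (tgt R e)" if "e \<in> edges R" for e
    using that by (simp add: ends_rhs new_edge_attrs)
  have 3: "tgt H e = tgt G e \<and> tgt G e \<in> nodes G" if "e \<in> old_edges" for e
    using that host_ends by (simp add: old_edge_attrs)
  note deg = degree [of "tgt L" "tgt G" "tgt R" "tgt H", OF 1 2 3, folded indeg_def]
  show "v \<in> old_nodes \<Longrightarrow> indeg H v = indeg G v" by (rule deg(1))
  show "v \<in> nodes R \<Longrightarrow> v \<notin> K \<Longrightarrow> indeg H (hV v) = indeg R v" by (rule deg(2))
  show "v \<in> K \<Longrightarrow> int (indeg H (hV v)) = int (indeg G (gV v)) + (int (indeg R v) - int (indeg L v))"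
    by (rule deg(3))
qed

lemma outdeg_H:
  shows "v \<in> old_nodes \<Longrightarrow> outdeg H v = outdeg G v"
    and "v \<in> nodes R \<Longrightarrow> v \<notin> K \<Longrightarrow> outdeg H (hV v) = outdeg R v"
    and "v \<in> K \<Longrightarrow> int (outdeg H (hV v)) = int (outdeg G (gV v)) + (int (outdeg R v) - int (outdeg L v))"
proof -
  have 1: "src L e \<in> nodes L \<and> src G (gE e) = gV (src L e)" if "e \<in> edges L" for e
    using that by (simp add: ends_lhs gE_src)
  have 2: "src R e \<in> nodes R \<and> src H (hE e) = hV (src R e)" if "e \<in> edges R" for e
    using that by (simp add: ends_rhs new_edge_attrs)
  have 3: "src H e = src G e \<and> src G e \<in> nodes G" if "e \<in> old_edges" for e
    using that host_ends by (simp add: old_edge_attrs)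
  note deg = degree [of "src L" "src G" "src R" "src H", OF 1 2 3, folded outdeg_def]
  show "v \<in> old_nodes \<Longrightarrow> outdeg H v = outdeg G v" by (rule deg(1))
  show "v \<in> nodes R \<Longrightarrow> v \<notin> K \<Longrightarrow> outdeg H (hV v) = outdeg R v" by (rule deg(2))
  show "v \<in> K \<Longrightarrow> int (outdeg H (hV v)) = int (outdeg G (gV v)) + (int (outdeg R v) - int (outdeg L v))"
    by (rule deg(3))
qed

section \<open>Relating assignments over the host graph and over the result graph\<close>

fun end_ok :: "nat option \<Rightarrow> nat \<Rightarrow> bool" where
  "end_ok None v = (v \<notin> gV ` nodes L)"
| "end_ok (Some u) v = (v = gV u)"

text \<open>A simulation relation: unprimed assignments belong to \<open>G\<close>, primed ones to
  \<open>H\<close>. The match must be encoded at all rule variables, whereas node and edge variables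
  of the formula are constrained on \<open>F\<close> only. For a closed formula the relation
  therefore holds initially even though shifted names denote arbitrary numbers.\<close>

definition env_rel where
  "env_rel F \<sigma> \<tau> \<nu> \<epsilon> \<alpha> \<nu>' \<epsilon>' \<alpha>' \<longleftrightarrow> valid_env \<sigma> \<tau> \<and>
     (\<forall>v \<in> nodes L. \<nu> v = gV v) \<and> (\<forall>e \<in> edges L. \<epsilon> e = gE e) \<and>
     (\<forall>x \<in> rgraph_vars L. \<alpha> x = \<alpha>0 x) \<and> \<alpha>' = \<alpha> \<circ> shift_var N \<and>
     (\<forall>x. NodeV x \<in> F \<longrightarrow> \<sigma> x = None \<longrightarrow> \<nu> (x + N) \<in> old_nodes \<and> \<nu>' x = \<nu> (x + N)) \<and>
     (\<forall>x v. NodeV x \<in> F \<longrightarrow> \<sigma> x = Some v \<longrightarrow> \<nu>' x = hV v) \<and>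
     (\<forall>x s t. EdgeV x \<in> F \<longrightarrow> \<tau> x = OldEdge s t \<longrightarrow>
       \<epsilon> (x + N) \<in> old_edges \<and> \<epsilon>' x = \<epsilon> (x + N) \<and>
       end_ok s (src G (\<epsilon> (x + N))) \<and> end_ok t (tgt G (\<epsilon> (x + N)))) \<and>
     (\<forall>x e. EdgeV x \<in> F \<longrightarrow> \<tau> x = NewEdge e \<longrightarrow> \<epsilon>' x = hE e)"

lemma env_rel_mono: "env_rel F \<sigma> \<tau> \<nu> \<epsilon> \<alpha> \<nu>' \<epsilon>' \<alpha>' \<Longrightarrow> F' \<subseteq> F \<Longrightarrow> env_rel F' \<sigma> \<tau> \<nu> \<epsilon> \<alpha> \<nu>' \<epsilon>' \<alpha>'"
  by (auto simp: env_rel_def)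

lemma env_rel_facts:
  assumes "env_rel F \<sigma> \<tau> \<nu> \<epsilon> \<alpha> \<nu>' \<epsilon>' \<alpha>'"
  shows "valid_env \<sigma> \<tau>" "v \<in> nodes L \<Longrightarrow> \<nu> v = gV v" "e \<in> edges L \<Longrightarrow> \<epsilon> e = gE e"
    "y \<in> rgraph_vars L \<Longrightarrow> \<alpha> y = \<alpha>0 y" "\<alpha>' = \<alpha> \<circ> shift_var N"
    and env_rel_old_node: "NodeV x \<in> F \<Longrightarrow> \<sigma> x = None \<Longrightarrow> \<nu> (x + N) \<in> old_nodes \<and> \<nu>' x = \<nu> (x + N)"
    and env_rel_new_node: "NodeV x \<in> F \<Longrightarrow> \<sigma> x = Some v \<Longrightarrow> \<nu>' x = hV v"
    and env_rel_old_edge: "EdgeV x \<in> F \<Longrightarrow> \<tau> x = OldEdge s t \<Longrightarrow>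
      \<epsilon> (x + N) \<in> old_edges \<and> \<epsilon>' x = \<epsilon> (x + N) \<and>
      end_ok s (src G (\<epsilon> (x + N))) \<and> end_ok t (tgt G (\<epsilon> (x + N)))"
    and env_rel_new_edge: "EdgeV x \<in> F \<Longrightarrow> \<tau> x = NewEdge e \<Longrightarrow> \<epsilon>' x = hE e"
  using assms by (simp_all add: env_rel_def)

lemma tr_n_old:
  assumes rel: "env_rel F \<sigma> \<tau> \<nu> \<epsilon> \<alpha> \<nu>' \<epsilon>' \<alpha>'" and fv: "fv_n n \<subseteq> F" and t: "tr_n \<sigma> \<tau> n = OldNode t"
  shows "neval H \<nu>' \<epsilon>' n = neval G \<nu> \<epsilon> t \<and> neval G \<nu> \<epsilon> t \<in> old_nodes"
proof (cases n)
  case (NVar x)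
  with t have "\<sigma> x = None" "t = NVar (x + N)" by (cases "\<sigma> x"; simp)+
  with NVar show ?thesis using env_rel_old_node [OF rel, of x] fv by simp
next
  case (NSrc e)
  \<comment> \<open>The inner case distinction is on the recorded source of an old edge. For a new
    edge the expression is unspecified, but that branch contradicts \<open>t\<close>.\<close>
  with t obtain u where "\<tau> e = OldEdge None u" "t = NSrc (e + N)"
    by (cases "\<tau> e"; cases "fst (case \<tau> e of OldEdge s u \<Rightarrow> (s, u))") auto
  with NSrc show ?thesis
    using env_rel_old_edge [OF rel, of e None u] fv old_edge_attrs [of "\<epsilon> (e + N)"] host_ends by simp
next
  case (NTgt e)
  with t obtain s where "\<tau> e = OldEdge s None" "t = NTgt (e + N)"
    by (cases "\<tau> e"; cases "snd (case \<tau> e of OldEdge s u \<Rightarrow> (s, u))") auto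
  with NTgt show ?thesis
    using env_rel_old_edge [OF rel, of e s None] fv old_edge_attrs [of "\<epsilon> (e + N)"] host_ends by simp
qed

lemma tr_n_new:
  assumes rel: "env_rel F \<sigma> \<tau> \<nu> \<epsilon> \<alpha> \<nu>' \<epsilon>' \<alpha>'" and fv: "fv_n n \<subseteq> F" and v: "tr_n \<sigma> \<tau> n = NewNode v"
  shows "neval H \<nu>' \<epsilon>' n = hV v \<and> v \<in> nodes R"
proof -
  note valid = env_rel_facts(1) [OF rel]
  have "neval H \<nu>' \<epsilon>' n = hV v"
  proof (cases n)
    case (NVar x)
    with v have "\<sigma> x = Some v" by (cases "\<sigma> x") auto
    with NVar show ?thesis using env_rel_new_node [OF rel, of x] fv by simp
  next
    case (NSrc e)
    show ?thesis
    proof (cases "\<tau> e")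
      case (OldEdge s u)
      with NSrc v have s: "s = Some v" by (cases s) auto
      \<comment> \<open>Only interface nodes are recorded as end points, and on them
        \<open>hV\<close> coincides with \<open>gV\<close>.\<close>
      then have "v \<in> K" using valid_env_OldEdge [OF valid OldEdge] by (auto simp: end_refs_def)
      with NSrc OldEdge s show ?thesis
        using env_rel_old_edge [OF rel, of e s u] fv old_edge_attrs [of "\<epsilon> (e + N)"] hV_iface by simp
    next
      case (NewEdge d)
      with NSrc v show ?thesis
        using env_rel_new_edge [OF rel, of e d] fv new_edge_attrs [OF valid_env_NewEdge [OF valid NewEdge]]
        by auto
    qed
  next
    case (NTgt e)
    show ?thesis
    proof (cases "\<tau> e")
      case (OldEdge s u)
      with NTgt v have u: "u = Some v" by (cases u) auto
      then have "v \<in> K" using valid_env_OldEdge [OF valid OldEdge] by (auto simp: end_refs_def)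
      with NTgt OldEdge u show ?thesis
        using env_rel_old_edge [OF rel, of e s u] fv old_edge_attrs [of "\<epsilon> (e + N)"] hV_iface by simp
    next
      case (NewEdge d)
      with NTgt v show ?thesis
        using env_rel_new_edge [OF rel, of e d] fv new_edge_attrs [OF valid_env_NewEdge [OF valid NewEdge]]
        by auto
    qed
  qed
  with tr_n_NewNode [OF valid v] show ?thesis by simp
qed

lemma fieval_indeg_exp:
  assumes rel: "env_rel F \<sigma> \<tau> \<nu> \<epsilon> \<alpha> \<nu>' \<epsilon>' \<alpha>'" and fv: "fv_n n \<subseteq> F"
  shows "fieval G \<nu> \<epsilon> \<alpha> (indeg_exp (tr_n \<sigma> \<tau> n)) = int (indeg H (neval H \<nu>' \<epsilon>' n))"
proof (cases "tr_n \<sigma> \<tau> n")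
  case (OldNode t)
  then show ?thesis using tr_n_old [OF rel fv OldNode] indeg_H(1) by simp
next
  case (NewNode v)
  then show ?thesis
    using tr_n_new [OF rel fv NewNode] indeg_H(2,3) [of v] env_rel_facts(2) [OF rel, of v] iface_lhs
    by simp
qed

lemma fieval_outdeg_exp:
  assumes rel: "env_rel F \<sigma> \<tau> \<nu> \<epsilon> \<alpha> \<nu>' \<epsilon>' \<alpha>'" and fv: "fv_n n \<subseteq> F"
  shows "fieval G \<nu> \<epsilon> \<alpha> (outdeg_exp (tr_n \<sigma> \<tau> n)) = int (outdeg H (neval H \<nu>' \<epsilon>' n))"
proof (cases "tr_n \<sigma> \<tau> n")
  case (OldNode t)
  then show ?thesis using tr_n_old [OF rel fv OldNode] outdeg_H(1) by simp
next
  case (NewNode v)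
  then show ?thesis
    using tr_n_new [OF rel fv NewNode] outdeg_H(2,3) [of v] env_rel_facts(2) [OF rel, of v] iface_lhs
    by simp
qed

lemma fieval_tr_i:
  assumes rel: "env_rel F \<sigma> \<tau> \<nu> \<epsilon> \<alpha> \<nu>' \<epsilon>' \<alpha>'"
  shows "fv_i a \<subseteq> F \<Longrightarrow> fieval G \<nu> \<epsilon> \<alpha> (tr_i \<sigma> \<tau> a) = fieval H \<nu>' \<epsilon>' \<alpha>' a"
proof (induction a)
  case (Indeg n)
  then show ?case using fieval_indeg_exp [OF rel] by simp
next
  case (Outdeg n)
  then show ?case using fieval_outdeg_exp [OF rel] by simp
qed (simp_all add: env_rel_facts(5) [OF rel])

lemma rleval_rhs_label:
  assumes rel: "env_rel F \<sigma> \<tau> \<nu> \<epsilon> \<alpha> \<nu>' \<epsilon>' \<alpha>'" and l: "l \<in> rgraph_labels R"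
  shows "rleval G \<nu> \<alpha> l = rleval G gV \<alpha>0 l"
proof -
  have "\<nu> v = gV v" if "v \<in> set_lexp l" for v
    using that rhs_label_vars [OF l] env_rel_facts(2) [OF rel] by blast
  moreover have "\<alpha> x = \<alpha>0 x" if "x \<in> lvars l" for x
    using that rhs_label_vars [OF l] env_rel_facts(4) [OF rel] by blast
  ultimately show ?thesis by (intro leval_cong) simp_all
qed

lemma teval_tr_l:
  assumes rel: "env_rel F \<sigma> \<tau> \<nu> \<epsilon> \<alpha> \<nu>' \<epsilon>' \<alpha>'"
  shows "fv_l t \<subseteq> F \<Longrightarrow> teval G \<nu> \<epsilon> \<alpha> (tr_l \<sigma> \<tau> t) = teval H \<nu>' \<epsilon>' \<alpha>' t"
proof (induction t)
  case (TAtom a)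
  then show ?case
    using fieval_tr_i [OF rel] by (cases a) (simp_all add: env_rel_facts(5) [OF rel] comp_def)
next
  case (TLabV n)
  then have fv: "fv_n n \<subseteq> F" by simp
  show ?case
  proof (cases "tr_n \<sigma> \<tau> n")
    case (OldNode t)
    then show ?thesis using tr_n_old [OF rel fv OldNode] old_node_attrs by simp
  next
    case (NewNode v)
    then show ?thesis
      using tr_n_new [OF rel fv NewNode] new_node_attrs rleval_rhs_label [OF rel rhs_nlabel] by simp
  qed
next
  case (TLabE e)
  then have fv: "EdgeV e \<in> F" by simp
  show ?case
  proof (cases "\<tau> e")
    case (OldEdge s u)
    then show ?thesis using env_rel_old_edge [OF rel fv OldEdge] old_edge_attrs by simp
  next
    case (NewEdge d)
    have "d \<in> edges R" using valid_env_NewEdge [OF env_rel_facts(1) [OF rel] NewEdge] .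
    with NewEdge show ?thesis
      using env_rel_new_edge [OF rel fv NewEdge] new_edge_attrs rleval_rhs_label [OF rel rhs_elabel] by simp
  qed
qed (simp_all add: env_rel_facts(5) [OF rel])

lemma nmeval_tr_nm:
  assumes rel: "env_rel F \<sigma> \<tau> \<nu> \<epsilon> \<alpha> \<nu>' \<epsilon>' \<alpha>'"
  shows "fv_nm t \<subseteq> F \<Longrightarrow> nmeval G \<nu> \<epsilon> (tr_nm \<sigma> \<tau> t) = nmeval H \<nu>' \<epsilon>' t"
proof (induction t)
  case (NMark n)
  then have fv: "fv_n n \<subseteq> F" by simp
  show ?case
  proof (cases "tr_n \<sigma> \<tau> n")
    case (OldNode t)
    then show ?thesis using tr_n_old [OF rel fv OldNode] old_node_attrs by simp
  next
    case (NewNode v)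
    note v = tr_n_new [OF rel fv NewNode]
    show ?thesis
    proof (cases "nmark R v")
      case (Mark m)
      then show ?thesis using NewNode v new_node_attrs by simp
    next
      case AnyMark
      then have "v \<in> nodes L" using v rhs_any_nmark iface_lhs by blast
      then show ?thesis
        using NewNode v new_node_attrs AnyMark env_rel_facts(2) [OF rel] by simp
    qed
  qed
qed simp

lemma emeval_tr_em:
  assumes rel: "env_rel F \<sigma> \<tau> \<nu> \<epsilon> \<alpha> \<nu>' \<epsilon>' \<alpha>'"
  shows "fv_em t \<subseteq> F \<Longrightarrow> emeval G \<epsilon> (tr_em \<tau> t) = emeval H \<epsilon>' t"
proof (induction t)
  case (EMark e)
  then have fv: "EdgeV e \<in> F" by simp
  show ?case
  proof (cases "\<tau> e")
    case (OldEdge s u)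
    then show ?thesis using env_rel_old_edge [OF rel fv OldEdge] old_edge_attrs by simp
  next
    case (NewEdge d)
    have d: "d \<in> edges R" using valid_env_NewEdge [OF env_rel_facts(1) [OF rel] NewEdge] .
    show ?thesis
    proof (cases "emark R d")
      case (Mark m)
      then show ?thesis using NewEdge d env_rel_new_edge [OF rel fv NewEdge] new_edge_attrs by simp
    next
      case AnyMark
      then have "d \<in> edges L" using d rhs_any_emark by blast
      then show ?thesis
        using NewEdge d env_rel_new_edge [OF rel fv NewEdge] new_edge_attrs AnyMark
          env_rel_facts(3) [OF rel] by simp
    qed
  qed
qed simp

text \<open>Rebinding the shifted name \<open>x + N\<close> leaves the match intact because rule
  names lie below \<open>N\<close>. The assumption omits \<open>x\<close> from the related
  variables, as the new binding overrides whatever \<open>x\<close> denoted before.\<close>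

lemma env_rel_upd_old_node:
  assumes "env_rel (F - {NodeV x}) \<sigma> \<tau> \<nu> \<epsilon> \<alpha> \<nu>' \<epsilon>' \<alpha>'" "v \<in> old_nodes"
  shows "env_rel F (\<sigma>(x := None)) \<tau> (\<nu>(x + N := v)) \<epsilon> \<alpha> (\<nu>'(x := v)) \<epsilon>' \<alpha>'"
proof -
  have "u \<noteq> x + N" if "u \<in> nodes L" for u using nodes_less [OF that] by simp
  with assms show ?thesis
    using valid_env_upd(1) [OF env_rel_facts(1) [OF assms(1)]] unfolding env_rel_def by simp
qed

lemma env_rel_upd_new_node:
  assumes "env_rel (F - {NodeV x}) \<sigma> \<tau> \<nu> \<epsilon> \<alpha> \<nu>' \<epsilon>' \<alpha>'" "v \<in> nodes R"
  shows "env_rel F (\<sigma>(x := Some v)) \<tau> \<nu> \<epsilon> \<alpha> (\<nu>'(x := hV v)) \<epsilon>' \<alpha>'"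
  using assms valid_env_upd(2) [OF env_rel_facts(1) [OF assms(1)]] unfolding env_rel_def by simp

lemma env_rel_upd_old_edge:
  assumes "env_rel (F - {EdgeV x}) \<sigma> \<tau> \<nu> \<epsilon> \<alpha> \<nu>' \<epsilon>' \<alpha>'" "e \<in> old_edges"
    "s \<in> end_refs" "t \<in> end_refs" "end_ok s (src G e)" "end_ok t (tgt G e)"
  shows "env_rel F \<sigma> (\<tau>(x := OldEdge s t)) \<nu> (\<epsilon>(x + N := e)) \<alpha> \<nu>' (\<epsilon>'(x := e)) \<alpha>'"
proof -
  have "d \<noteq> x + N" if "d \<in> edges L" for d using edges_less [OF that] by simp
  with assms show ?thesis
    using valid_env_upd(3) [OF env_rel_facts(1) [OF assms(1)] assms(3,4)] unfolding env_rel_def by simp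
qed

lemma env_rel_upd_new_edge:
  assumes "env_rel (F - {EdgeV x}) \<sigma> \<tau> \<nu> \<epsilon> \<alpha> \<nu>' \<epsilon>' \<alpha>'" "e \<in> edges R"
  shows "env_rel F \<sigma> (\<tau>(x := NewEdge e)) \<nu> \<epsilon> \<alpha> \<nu>' (\<epsilon>'(x := hE e)) \<alpha>'"
  using assms valid_env_upd(4) [OF env_rel_facts(1) [OF assms(1)]] unfolding env_rel_def by simp

lemma env_rel_upd_label:
  assumes "env_rel (F - {LabelV x}) \<sigma> \<tau> \<nu> \<epsilon> \<alpha> \<nu>' \<epsilon>' \<alpha>'"
  shows "env_rel F \<sigma> \<tau> \<nu> \<epsilon> (\<alpha>(shift_var N x := l)) \<nu>' \<epsilon>' (\<alpha>'(x := l))"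
proof -
  have "y \<noteq> shift_var N x" if "y \<in> rgraph_vars L" for y
    using vars_less [OF that] by auto
  \<comment> \<open>The shift is injective, so the update hits the image of \<open>x\<close> and of
    no other variable.\<close>
  moreover have "(\<alpha> \<circ> shift_var N)(x := l) = \<alpha>(shift_var N x := l) \<circ> shift_var N"
    by (auto simp: fun_eq_iff)
  ultimately show ?thesis using assms unfolding env_rel_def by simp
qed

lemma sat_node_is:
  assumes "\<And>v. v \<in> nodes L \<Longrightarrow> \<nu> v = gV v" "u \<in> end_refs"
  shows "sat G \<nu> \<epsilon> \<alpha> (node_is t u) \<longleftrightarrow> end_ok u (neval G \<nu> \<epsilon> t)"
proof (cases u)
  case None
  with assms(1) show ?thesis by auto
next
  case (Some v)
  with assms iface_lhs show ?thesis by (auto simp: end_refs_def)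
qed

text \<open>The left-hand side mentions neither \<open>hV\<close> nor \<open>hE\<close>, so the
  truth of a closed formula in \<open>H\<close> is determined by \<open>G\<close> and the match.
  Atoms follow from the evaluation lemmas; the quantifiers follow from the partitions
  \<open>nodes_H\<close> and \<open>edges_H\<close>.\<close>

lemma sat_tr:
  "env_rel (fv c) \<sigma> \<tau> \<nu> \<epsilon> \<alpha> \<nu>' \<epsilon>' \<alpha>' \<Longrightarrow> sat G \<nu> \<epsilon> \<alpha> (tr \<sigma> \<tau> c) = sat H \<nu>' \<epsilon>' \<alpha>' c"
proof (induction c arbitrary: \<sigma> \<tau> \<nu> \<epsilon> \<alpha> \<nu>' \<epsilon>' \<alpha>')
  case (FInt t)
  then show ?case using teval_tr_l [OF FInt] by simp
next
  case (FChar t)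
  then show ?case using teval_tr_l [OF FChar] by simp
next
  case (FString t)
  then show ?case using teval_tr_l [OF FString] by simp
next
  case (FAtom t)
  then show ?case using teval_tr_l [OF FAtom] by simp
next
  case (FRoot n)
  show ?case
  proof (cases "tr_n \<sigma> \<tau> n")
    case (OldNode t)
    then show ?thesis using tr_n_old [OF FRoot _ OldNode] old_node_attrs by simp
  next
    case (NewNode v)
    then show ?thesis using tr_n_new [OF FRoot _ NewNode] new_node_attrs by simp
  qed
next
  case (FEqL s t)
  then show ?case using teval_tr_l [OF FEqL, of s] teval_tr_l [OF FEqL, of t] by simp
next
  case (FRel q a b)
  then show ?case using fieval_tr_i [OF FRel, of a] fieval_tr_i [OF FRel, of b] by simp
next
  case (FEqN m n)
  have m: "fv_n m \<subseteq> fv (FEqN m n)" and n: "fv_n n \<subseteq> fv (FEqN m n)" by simp_all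
  note old = tr_n_old [OF FEqN m] tr_n_old [OF FEqN n]
  note new = tr_n_new [OF FEqN m] tr_n_new [OF FEqN n]
  show ?case
  proof (cases "tr_n \<sigma> \<tau> m"; cases "tr_n \<sigma> \<tau> n")
    fix s t assume "tr_n \<sigma> \<tau> m = OldNode s" "tr_n \<sigma> \<tau> n = OldNode t"
    then show ?thesis using old by simp
  next
    fix s v assume *: "tr_n \<sigma> \<tau> m = OldNode s" "tr_n \<sigma> \<tau> n = NewNode v"
    then have "neval H \<nu>' \<epsilon>' m \<in> old_nodes" "neval H \<nu>' \<epsilon>' n \<notin> old_nodes"
      using old(1) new(2) hV_not_old [of v] by simp_all
    then have "neval H \<nu>' \<epsilon>' m \<noteq> neval H \<nu>' \<epsilon>' n" by metis
    with * show ?thesis by simp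
  next
    fix v s assume *: "tr_n \<sigma> \<tau> m = NewNode v" "tr_n \<sigma> \<tau> n = OldNode s"
    then have "neval H \<nu>' \<epsilon>' m \<notin> old_nodes" "neval H \<nu>' \<epsilon>' n \<in> old_nodes"
      using old(2) new(1) hV_not_old [of v] by simp_all
    then have "neval H \<nu>' \<epsilon>' m \<noteq> neval H \<nu>' \<epsilon>' n" by metis
    with * show ?thesis by simp
  next
    fix u v assume "tr_n \<sigma> \<tau> m = NewNode u" "tr_n \<sigma> \<tau> n = NewNode v"
    then show ?thesis using new inj_on_eq_iff [OF inj_hV] by simp
  qed
next
  case (FEqE d e)
  have d: "EdgeV d \<in> fv (FEqE d e)" and e: "EdgeV e \<in> fv (FEqE d e)" by simp_all
  note old = env_rel_old_edge [OF FEqE d] env_rel_old_edge [OF FEqE e]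
  note new = env_rel_new_edge [OF FEqE d] env_rel_new_edge [OF FEqE e]
  note new_in = valid_env_NewEdge [OF env_rel_facts(1) [OF FEqE]]
  show ?case
  proof (cases "\<tau> d"; cases "\<tau> e")
    fix s t s' t' assume "\<tau> d = OldEdge s t" "\<tau> e = OldEdge s' t'"
    then show ?thesis using old by simp
  next
    fix s t d' assume *: "\<tau> d = OldEdge s t" "\<tau> e = NewEdge d'"
    then have "\<epsilon>' d \<in> old_edges" "\<epsilon>' e \<notin> old_edges"
      using old(1) new(2) hE_not_old [of d'] new_in by simp_all
    then have "\<epsilon>' d \<noteq> \<epsilon>' e" by metis
    with * show ?thesis by simp
  next
    fix d' s t assume *: "\<tau> d = NewEdge d'" "\<tau> e = OldEdge s t"
    then have "\<epsilon>' d \<notin> old_edges" "\<epsilon>' e \<in> old_edges"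
      using old(2) new(1) hE_not_old [of d'] new_in by simp_all
    then have "\<epsilon>' d \<noteq> \<epsilon>' e" by metis
    with * show ?thesis by simp
  next
    fix d' e' assume "\<tau> d = NewEdge d'" "\<tau> e = NewEdge e'"
    then show ?thesis using new new_in inj_on_eq_iff [OF inj_hE] by simp
  qed
next
  case (FEqNM s t)
  then show ?case using nmeval_tr_nm [OF FEqNM, of s] nmeval_tr_nm [OF FEqNM, of t] by simp
next
  case (FEqEM s t)
  then show ?case using emeval_tr_em [OF FEqEM, of s] emeval_tr_em [OF FEqEM, of t] by simp
next
  case (FNot c)
  then have "sat G \<nu> \<epsilon> \<alpha> (tr \<sigma> \<tau> c) = sat H \<nu>' \<epsilon>' \<alpha>' c" by simp
  then show ?case by simp
next
  case (FAnd c d)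
  have "sat G \<nu> \<epsilon> \<alpha> (tr \<sigma> \<tau> c) = sat H \<nu>' \<epsilon>' \<alpha>' c" "sat G \<nu> \<epsilon> \<alpha> (tr \<sigma> \<tau> d) = sat H \<nu>' \<epsilon>' \<alpha>' d"
    by (rule FAnd.IH, rule env_rel_mono [OF FAnd.prems], simp)+
  then show ?case by simp
next
  case (FOr c d)
  have "sat G \<nu> \<epsilon> \<alpha> (tr \<sigma> \<tau> c) = sat H \<nu>' \<epsilon>' \<alpha>' c" "sat G \<nu> \<epsilon> \<alpha> (tr \<sigma> \<tau> d) = sat H \<nu>' \<epsilon>' \<alpha>' d"
    by (rule FOr.IH, rule env_rel_mono [OF FOr.prems], simp)+
  then show ?case by simp
next
  case (FExV x c)
  have rel: "env_rel (fv c - {NodeV x}) \<sigma> \<tau> \<nu> \<epsilon> \<alpha> \<nu>' \<epsilon>' \<alpha>'" using FExV.prems by simp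
  have old: "sat G (\<nu>(x + N := v)) \<epsilon> \<alpha> (tr (\<sigma>(x := None)) \<tau> c) = sat H (\<nu>'(x := v)) \<epsilon>' \<alpha>' c"
    if "v \<in> old_nodes" for v
    by (rule FExV.IH) (rule env_rel_upd_old_node [OF rel that])
  have new: "sat G \<nu> \<epsilon> \<alpha> (tr (\<sigma>(x := Some v)) \<tau> c) = sat H (\<nu>'(x := hV v)) \<epsilon>' \<alpha>' c"
    if "v \<in> nodes R" for v
    by (rule FExV.IH) (rule env_rel_upd_new_node [OF rel that])
  have "sat G (\<nu>(x + N := v)) \<epsilon> \<alpha> (node_is (NVar (x + N)) None) \<longleftrightarrow> v \<notin> gV ` nodes L" for v
    using sat_node_is [of "\<nu>(x + N := v)" None \<epsilon> \<alpha> "NVar (x + N)"] env_rel_facts(2) [OF rel] nodes_less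
    by (force simp: end_refs_def simp del: node_is.simps)
  then have "sat G \<nu> \<epsilon> \<alpha> (tr \<sigma> \<tau> (FExV x c)) \<longleftrightarrow>
      (\<exists>v \<in> old_nodes. sat G (\<nu>(x + N := v)) \<epsilon> \<alpha> (tr (\<sigma>(x := None)) \<tau> c)) \<or>
      (\<exists>v \<in> nodes R. sat G \<nu> \<epsilon> \<alpha> (tr (\<sigma>(x := Some v)) \<tau> c))"
    by (auto simp del: node_is.simps)
  also have "\<dots> \<longleftrightarrow> (\<exists>v \<in> old_nodes. sat H (\<nu>'(x := v)) \<epsilon>' \<alpha>' c) \<or>
      (\<exists>v \<in> nodes R. sat H (\<nu>'(x := hV v)) \<epsilon>' \<alpha>' c)"
    using old new by (metis (no_types, lifting))
  also have "\<dots> \<longleftrightarrow> sat H \<nu>' \<epsilon>' \<alpha>' (FExV x c)"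
    unfolding sat.simps nodes_H by blast
  finally show ?case .
next
  case (FExE x c)
  have rel: "env_rel (fv c - {EdgeV x}) \<sigma> \<tau> \<nu> \<epsilon> \<alpha> \<nu>' \<epsilon>' \<alpha>'" using FExE.prems by simp
  let ?ok = "\<lambda>e s t. end_ok s (src G e) \<and> end_ok t (tgt G e)"
  have old: "sat G \<nu> (\<epsilon>(x + N := e)) \<alpha> (tr \<sigma> (\<tau>(x := OldEdge s t)) c) = sat H \<nu>' (\<epsilon>'(x := e)) \<alpha>' c"
    if "e \<in> old_edges" "s \<in> end_refs" "t \<in> end_refs" "?ok e s t" for e s t
    by (rule FExE.IH) (use env_rel_upd_old_edge [OF rel that(1-3)] that(4) in blast)
  have new: "sat G \<nu> \<epsilon> \<alpha> (tr \<sigma> (\<tau>(x := NewEdge e)) c) = sat H \<nu>' (\<epsilon>'(x := hE e)) \<alpha>' c"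
    if "e \<in> edges R" for e
    by (rule FExE.IH) (rule env_rel_upd_new_edge [OF rel that])
  \<comment> \<open>At least one guess about the end points succeeds, by the dangling
    condition.\<close>
  have ex: "\<exists>s \<in> end_refs. \<exists>t \<in> end_refs. ?ok e s t" if "e \<in> old_edges" for e
    using old_edge_end [OF that] unfolding end_refs_def by auto
  have outside: "(\<forall>d \<in> edges L. e \<noteq> (\<epsilon>(x + N := e)) d) \<longleftrightarrow> e \<notin> gE ` edges L" for e
    using env_rel_facts(3) [OF rel] edges_less by force
  have ends: "sat G \<nu> (\<epsilon>(x + N := e)) \<alpha> (node_is (NSrc (x + N)) u) \<longleftrightarrow> end_ok u (src G e)"
    "sat G \<nu> (\<epsilon>(x + N := e)) \<alpha> (node_is (NTgt (x + N)) u) \<longleftrightarrow> end_ok u (tgt G e)"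
    if "u \<in> end_refs" for e u
    using sat_node_is [OF env_rel_facts(2) [OF rel] that, of "\<epsilon>(x + N := e)" \<alpha>]
    by (simp_all del: node_is.simps)
  have "sat G \<nu> \<epsilon> \<alpha> (tr \<sigma> \<tau> (FExE x c)) \<longleftrightarrow>
      (\<exists>e \<in> old_edges. \<exists>s \<in> end_refs. \<exists>t \<in> end_refs. ?ok e s t \<and>
         sat G \<nu> (\<epsilon>(x + N := e)) \<alpha> (tr \<sigma> (\<tau>(x := OldEdge s t)) c)) \<or>
      (\<exists>e \<in> edges R. sat G \<nu> \<epsilon> \<alpha> (tr \<sigma> (\<tau>(x := NewEdge e)) c))"
    using outside by (simp add: ends del: node_is.simps) blast
  \<comment> \<open>The guess drops out: every successful pair gives the same truth value over
    \<open>H\<close>, and a successful pair exists.\<close>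
  also have "\<dots> \<longleftrightarrow> (\<exists>e \<in> old_edges. sat H \<nu>' (\<epsilon>'(x := e)) \<alpha>' c) \<or>
      (\<exists>e \<in> edges R. sat H \<nu>' (\<epsilon>'(x := hE e)) \<alpha>' c)"
    using old new ex by (metis (no_types, lifting))
  also have "\<dots> \<longleftrightarrow> sat H \<nu>' \<epsilon>' \<alpha>' (FExE x c)"
    unfolding sat.simps edges_H by blast
  finally show ?case .
next
  case (FExL x c)
  have rel: "env_rel (fv c - {LabelV x}) \<sigma> \<tau> \<nu> \<epsilon> \<alpha> \<nu>' \<epsilon>' \<alpha>'" using FExL.prems by simp
  have "sat G \<nu> \<epsilon> (\<alpha>(shift_var N x := l)) (tr \<sigma> \<tau> c) = sat H \<nu>' \<epsilon>' (\<alpha>'(x := l)) c" for l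
    by (rule FExL.IH) (rule env_rel_upd_label [OF rel])
  then show ?case by simp
qed simp_all

end

section \<open>Preconditions of rules\<close>

lemma finite_below: "finite A \<Longrightarrow> \<exists>m. \<forall>v \<in> A. v < m" for A :: "nat set"
  by (simp add: finite_nat_set_iff_bounded)

text \<open>A finite graph always leaves fresh identifiers, so no match is blocked and applicability
  of a rule amounts to the existence of a match.\<close>

lemma result_exists:
  assumes "wf_rule r" "host_graph G" "is_match r G gV gE \<alpha>"
  shows "\<exists>hV hE H. is_result r G gV gE \<alpha> hV hE H"
proof -
  let ?L = "lhs r" and ?R = "rhs r" and ?K = "iface r"
  obtain m where m: "\<And>v. v \<in> nodes G \<Longrightarrow> v < m"
    using assms(2) finite_below [of "nodes G"] by (auto simp: wf_graph_def)
  obtain k where k: "\<And>e. e \<in> edges G \<Longrightarrow> e < k"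
    using assms(2) finite_below [of "edges G"] by (auto simp: wf_graph_def)
  have inj_gV: "inj_on gV (nodes ?L)" and gV: "gV ` nodes ?L \<subseteq> nodes G"
    using assms(3) by (simp_all add: is_match_def Let_def)
  have K: "?K \<subseteq> nodes ?L" using assms(1) by (simp add: wf_rule_def)
  \<comment> \<open>All nodes of \<open>G\<close> lie below \<open>m\<close> and all edges below
    \<open>k\<close>. Adding these bounds yields fresh identifiers and cannot collide with the
    images of interface nodes.\<close>
  define hV where "hV v = (if v \<in> ?K then gV v else v + m)" for v
  define hE where "hE e = e + k" for e
  \<comment> \<open>For edges, comparison with \<open>k\<close> separates old from new. Right-hand
    nodes may be preserved ones below \<open>m\<close>, so their attributes are found through the
    inverse of \<open>hV\<close>.\<close>
  define H where "H = \<lparr>nodes = (nodes G - gV ` (nodes ?L - ?K)) \<union> hV ` nodes ?R,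
    edges = (edges G - gE ` edges ?L) \<union> hE ` edges ?R,
    src = (\<lambda>e. if e < k then src G e else hV (src ?R (e - k))),
    tgt = (\<lambda>e. if e < k then tgt G e else hV (tgt ?R (e - k))),
    nlabel = (\<lambda>v. if v \<in> hV ` nodes ?R then rleval G gV \<alpha> (nlabel ?R (inv_into (nodes ?R) hV v))
      else nlabel G v),
    elabel = (\<lambda>e. if e < k then elabel G e else rleval G gV \<alpha> (elabel ?R (e - k))),
    nmark = (\<lambda>v. if v \<in> hV ` nodes ?R then
        (let u = inv_into (nodes ?R) hV v in new_mark (nmark G (gV u)) (nmark ?R u)) else nmark G v),
    emark = (\<lambda>e. if e < k then emark G e else new_mark (emark G (gE (e - k))) (emark ?R (e - k))),
    rooted = (\<lambda>v. if v \<in> hV ` nodes ?R then rooted ?R (inv_into (nodes ?R) hV v) else rooted G v)\<rparr>"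
  have gV_less: "gV v < m" if "v \<in> ?K" for v using that K gV m by blast
  have inj: "inj_on hV (nodes ?R)"
  proof (rule inj_onI)
    fix u v assume "hV u = hV v"
    then show "u = v"
      using gV_less [of u] gV_less [of v] K inj_onD [OF inj_gV, of u v]
      by (auto simp: hV_def split: if_splits)
  qed
  have old: "v \<notin> hV ` nodes ?R" if "v \<in> nodes G - gV ` nodes ?L" for v
    using that m [of v] K by (auto simp: hV_def)
  have fresh: "hV ` (nodes ?R - ?K) \<inter> nodes G = {}" using m by (auto simp: hV_def)
  have fresh_edges: "hE ` edges ?R \<inter> edges G = {}" using k by (auto simp: hE_def)
  have "is_result r G gV gE \<alpha> hV hE H"
    unfolding is_result_def Let_def
  proof (intro conjI)
    show "\<forall>v \<in> ?K. hV v = gV v" by (simp add: hV_def)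
    show "inj_on hE (edges ?R)" by (simp add: hE_def inj_on_def)
    show "\<forall>v \<in> nodes G - gV ` nodes ?L.
        nlabel H v = nlabel G v \<and> nmark H v = nmark G v \<and> rooted H v = rooted G v"
      using old by (simp add: H_def)
    show "\<forall>v \<in> nodes ?R. nlabel H (hV v) = rleval G gV \<alpha> (nlabel ?R v) \<and>
        nmark H (hV v) = new_mark (nmark G (gV v)) (nmark ?R v) \<and> rooted H (hV v) = rooted ?R v"
      using inj by (simp add: H_def)
    show "\<forall>e \<in> edges G - gE ` edges ?L. src H e = src G e \<and> tgt H e = tgt G e \<and>
        elabel H e = elabel G e \<and> emark H e = emark G e"
      using k by (simp add: H_def)
    show "\<forall>e \<in> edges ?R. src H (hE e) = hV (src ?R e) \<and> tgt H (hE e) = hV (tgt ?R e) \<and>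
        elabel H (hE e) = rleval G gV \<alpha> (elabel ?R e) \<and>
        emark H (hE e) = new_mark (emark G (gE e)) (emark ?R e)"
      by (simp add: H_def hE_def)
  qed (use inj fresh fresh_edges in \<open>simp_all add: H_def\<close>)
  then show ?thesis by blast
qed

lemma well_typed_exists: "\<exists>\<alpha>. well_typed \<alpha>"
proof -
  have "\<exists>l. l \<in> vdom x" for x
    by (cases x) (auto simp: is_int_def is_char_def is_string_def is_atom_def)
  then show ?thesis unfolding well_typed_def by metis
qed

lemma ex_shifted_rule:
  assumes "wf_rule r"
  shows "\<exists>N. shifted_rule r N"
proof -
  have fin: "finite (nodes (lhs r))" "finite (edges (lhs r))"
    using assms by (auto simp: wf_rule_def wf_graph_def)
  then have "finite (nodes (lhs r) \<union> edges (lhs r) \<union> var_index ` rgraph_vars (lhs r))"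
    by (simp add: rgraph_vars_def rgraph_labels_def)
  from finite_below [OF this]
  obtain N where "\<forall>x \<in> nodes (lhs r) \<union> edges (lhs r) \<union> var_index ` rgraph_vars (lhs r). x < N" ..
  then have "shifted_rule r N" using assms by unfold_locales auto
  then show ?thesis ..
qed

lemma derives_host_graph:
  assumes "wf_rule r" "host_graph G" "derives G r H"
  shows "host_graph H"
proof -
  obtain N where "shifted_rule r N" using ex_shifted_rule [OF assms(1)] ..
  moreover obtain gV gE \<alpha> hV hE where "is_match r G gV gE \<alpha>" "is_result r G gV gE \<alpha> hV hE H"
    using assms(3) by (auto simp: derives_def)
  ultimately have "derivation r N G H gV gE hV hE \<alpha>"
    using assms(2) by (simp add: derivation_def derivation_axioms_def)
  then show ?thesis by (rule derivation.host_result)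
qed

text \<open>The translated formula has the same value as the property at every result of a match.
  Hence the formula can quantify over matches instead of result graphs, and
  \<open>result_exists\<close> turns a match back into a derivation.\<close>

lemma expressible_derives:
  assumes "wf_rule r" "expressible \<Phi>"
  shows "expressible (\<lambda>G. \<exists>H. derives G r H \<and> \<Phi> H)"
proof -
  obtain c where c: "fv c = {}" "\<And>G \<nu> \<epsilon> \<alpha>. host_graph G \<Longrightarrow> sat G \<nu> \<epsilon> \<alpha> c \<longleftrightarrow> \<Phi> G"
    using expressibleE [OF assms(2)] by blast
  obtain N where "shifted_rule r N" using ex_shifted_rule [OF assms(1)] ..
  then interpret shifted_rule r N .
  define c' where "c' = tr (\<lambda>_. None) (\<lambda>_. OldEdge None None) c"
  have valid: "valid_env (\<lambda>_. None) (\<lambda>_. OldEdge None None)"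
    by (simp add: valid_env_def end_refs_def)
  have c': "sat G gV gE \<alpha> c' \<longleftrightarrow> \<Phi> H"
    if "host_graph G" "is_match r G gV gE \<alpha>" "is_result r G gV gE \<alpha> hV hE H" for G gV gE \<alpha> hV hE H
  proof -
    interpret derivation r N G H gV gE hV hE \<alpha>
      using that by unfold_locales
    \<comment> \<open>As \<open>c\<close> is closed, the node and edge assignments over
      \<open>H\<close> are arbitrary; those of the match are reused.\<close>
    have "env_rel (fv c) (\<lambda>_. None) (\<lambda>_. OldEdge None None) gV gE \<alpha> gV gE (\<alpha> \<circ> shift_var N)"
      using valid by (simp add: env_rel_def c(1))
    from sat_tr [OF this] show ?thesis using c(2) [OF host_result] by (simp add: c'_def)
  qed
  have finite_vars: "finite (rgraph_vars L)"
    by (simp add: rgraph_vars_def rgraph_labels_def)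
  let ?body = "FAnd (match_form N r) c'"
  let ?d = "foldr FExV (list_of (nodes L)) (foldr FExE (list_of (edges L))
    (foldr FExL (list_of (rgraph_vars L)) ?body))"
  have "fv ?body \<subseteq> rule_fv r"
    using fv_match_form [OF wf_rule] fv_tr [OF valid, of c] c(1) by (simp add: c'_def)
  then have fv: "fv ?d = {}"
    using finite_vars by (auto simp: rule_fv_def)
  show ?thesis
  proof (rule expressibleI [OF fv])
    fix G :: host assume G: "host_graph G"
    show "\<exists>\<nu> \<epsilon> \<alpha>. sat G \<nu> \<epsilon> \<alpha> ?d \<longleftrightarrow> (\<exists>H. derives G r H \<and> \<Phi> H)"
    proof (cases "\<exists>H. derives G r H \<and> \<Phi> H")
      case True
      then obtain H gV gE \<alpha> hV hE where match: "is_match r G gV gE \<alpha>"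
        and result: "is_result r G gV gE \<alpha> hV hE H" and "\<Phi> H"
        by (auto simp: derives_def)
      have wt: "well_typed \<alpha>" and gV: "gV ` nodes L \<subseteq> nodes G" and gE: "gE ` edges L \<subseteq> edges G"
        using match by (simp_all add: is_match_def Let_def)
      have "sat G gV gE \<alpha> ?body"
        using match \<open>\<Phi> H\<close> c' [OF G match result] edges_less
        by (simp add: sat_match_form [OF wf_rule _ wt gV gE])
      then have "sat G gV gE \<alpha> (foldr FExL (list_of (rgraph_vars L)) ?body)"
        unfolding sat_FExL_block using wt by (auto simp: well_typed_def)
      then have "sat G gV gE \<alpha> (foldr FExE (list_of (edges L)) (foldr FExL (list_of (rgraph_vars L)) ?body))"
        unfolding sat_FExE_block using gE by (intro exI [of _ gE]) auto
      then have "sat G gV gE \<alpha> ?d"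
        unfolding sat_FExV_block using gV by (intro exI [of _ gV]) auto
      with True show ?thesis by blast
    next
      case False
      \<comment> \<open>A match must be well typed at all variables, including those that the
        quantifier block leaves untouched; these keep their values from this assignment.\<close>
      obtain \<alpha> where wt: "well_typed \<alpha>" using well_typed_exists ..
      have "\<not> sat G \<nu> \<epsilon> \<alpha> ?d" for \<nu> \<epsilon>
      proof
        assume "sat G \<nu> \<epsilon> \<alpha> ?d"
        then obtain gV where gV: "gV ` nodes L \<subseteq> nodes G"
          and "sat G gV \<epsilon> \<alpha> (foldr FExE (list_of (edges L)) (foldr FExL (list_of (rgraph_vars L)) ?body))"
          unfolding sat_FExV_block by auto
        then obtain gE where gE: "gE ` edges L \<subseteq> edges G"
          and "sat G gV gE \<alpha> (foldr FExL (list_of (rgraph_vars L)) ?body)"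
          unfolding sat_FExE_block by auto
        then obtain \<alpha>' where \<alpha>': "\<forall>x \<in> rgraph_vars L. \<alpha>' x \<in> vdom x"
            "\<forall>x. x \<notin> rgraph_vars L \<longrightarrow> \<alpha>' x = \<alpha> x" and body: "sat G gV gE \<alpha>' ?body"
          unfolding sat_FExL_block set_list_of [OF finite_vars] by blast
        have wt': "well_typed \<alpha>'"
          using \<alpha>' wt unfolding well_typed_def by metis
        have match: "is_match r G gV gE \<alpha>'"
          using body edges_less by (simp add: sat_match_form [OF wf_rule _ wt' gV gE])
        then obtain hV hE H where result: "is_result r G gV gE \<alpha>' hV hE H"
          using result_exists [OF wf_rule G] by blast
        with match have "derives G r H" unfolding derives_def by blast
        moreover have "\<Phi> H" using body c' [OF G match result] by simp
        ultimately show False using False by blast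
      qed
      with False show ?thesis by blast
    qed
  qed
qed

section \<open>Programs outside loops\<close>

abbreviation runs :: "prog \<Rightarrow> host \<Rightarrow> config \<Rightarrow> bool" where
  "runs P G \<equiv> (step False)\<^sup>*\<^sup>* (Run P G)"

fun final :: "config \<Rightarrow> bool" where
  "final (Run P G) = False"
| "final (Done H) = True"
| "final Failed = True"

inductive_cases step_DoneE [elim!]: "step b (Done H) c"
inductive_cases step_FailedE [elim!]: "step b Failed c"
inductive_cases step_CallE: "step b (Run (Call rs) G) c"
inductive_cases step_BreakE: "step b (Run Break G) c"
inductive_cases step_OrE: "step b (Run (Or P Q) G) c"
text \<open>With the flag fixed to \<open>False\<close> the rules that propagate
  \<open>break\<close> to an enclosing loop drop out, and the commands obey plain equations.\<close>

inductive_cases step_SeqE: "step False (Run (Seq P Q) G) c"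
inductive_cases step_IfE: "step False (Run (If C P Q) G) c"
inductive_cases step_TryE: "step False (Run (Try C P Q) G) c"
inductive_cases step_LoopE: "step b (Run (Loop P) G) c"

lemma final_reach [simp]:
  "final c \<Longrightarrow> (step b)\<^sup>*\<^sup>* c d \<longleftrightarrow> d = c"
  by (cases c) (auto elim: converse_rtranclpE)

lemma tranclp_Run_iff:
  "final c \<Longrightarrow> (step b)\<^sup>+\<^sup>+ (Run P G) c \<longleftrightarrow> (step b)\<^sup>*\<^sup>* (Run P G) c"
  by (auto dest: tranclp_into_rtranclp rtranclpD)

lemma tranclp_Done: "(step b)\<^sup>*\<^sup>* (Run P G) (Done H) \<Longrightarrow> (step b)\<^sup>+\<^sup>+ (Run P G) (Done H)"
  and tranclp_Failed: "(step b)\<^sup>*\<^sup>* (Run P G) Failed \<Longrightarrow> (step b)\<^sup>+\<^sup>+ (Run P G) Failed"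
  by (simp_all add: tranclp_Run_iff)

lemma runs_unfold:
  "final c \<Longrightarrow> runs P G c \<longleftrightarrow> (\<exists>d. step False (Run P G) d \<and> (step False)\<^sup>*\<^sup>* d c)"
  by (auto elim: converse_rtranclpE intro: converse_rtranclp_into_rtranclp)

lemma runs_Call_Done: "runs (Call rs) G (Done H) \<longleftrightarrow> (\<exists>r \<in> set rs. derives G r H)"
  by (auto simp: runs_unfold elim!: step_CallE intro: call1)

lemma runs_Call_Failed: "runs (Call rs) G Failed \<longleftrightarrow> \<not> (\<exists>r \<in> set rs. \<exists>H. derives G r H)"
  by (auto simp: runs_unfold elim!: step_CallE intro: call2)

lemma runs_Break: "final c \<Longrightarrow> runs Break G c \<longleftrightarrow> c = Done G"
  by (auto simp: runs_unfold elim!: step_BreakE intro: break_outside)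

lemma runs_Or: "final c \<Longrightarrow> runs (Or P Q) G c \<longleftrightarrow> runs P G c \<or> runs Q G c"
  by (subst runs_unfold) (auto elim!: step_OrE intro: or1 or2)

lemma runs_If:
  "final c \<Longrightarrow> runs (If C P Q) G c \<longleftrightarrow>
     (\<exists>H. runs C G (Done H)) \<and> runs P G c \<or> runs C G Failed \<and> runs Q G c"
  by (subst runs_unfold) (auto elim!: step_IfE simp: tranclp_Run_iff intro: if1 [OF tranclp_Done] if2 [OF tranclp_Failed])

lemma runs_Try:
  "final c \<Longrightarrow> runs (Try C P Q) G c \<longleftrightarrow>
     (\<exists>H. runs C G (Done H) \<and> runs P H c) \<or> runs C G Failed \<and> runs Q G c"
  by (subst runs_unfold) (auto elim!: step_TryE simp: tranclp_Run_iff intro: try1 [OF tranclp_Done] try2 [OF tranclp_Failed])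

lemma runs_SeqD:
  assumes "(step False)\<^sup>*\<^sup>* x c" "x = Run (Seq P Q) G" "final c"
  shows "c = Failed \<and> runs P G Failed \<or> (\<exists>H. runs P G (Done H) \<and> runs Q H c)"
  using assms
proof (induction arbitrary: P G rule: converse_rtranclp_induct)
  case base
  then show ?case by simp
next
  case (step x y)
  from step.hyps(1) show ?case unfolding \<open>x = Run (Seq P Q) G\<close>
  proof (rule step_SeqE)
    fix P' H assume P': "y = Run (Seq P' Q) H" "step False (Run P G) (Run P' H)"
    from step.IH [OF P'(1) \<open>final c\<close>] P'(2) show ?thesis
      by (blast intro: converse_rtranclp_into_rtranclp)
  next
    fix H assume "y = Run Q H" "step False (Run P G) (Done H)"
    then show ?thesis using step.hyps(2) by blast
  next
    assume "y = Failed" "step False (Run P G) Failed"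
    then show ?thesis using step.hyps(2) by auto
  qed
qed

lemma runs_SeqI1:
  assumes "(step False)\<^sup>*\<^sup>* x (Done H)" "x = Run P G"
  shows "runs (Seq P Q) G (Run Q H)"
  using assms
proof (induction arbitrary: P G rule: converse_rtranclp_induct)
  case (step x y)
  then show ?case
    by (cases y) (auto intro: converse_rtranclp_into_rtranclp seq1 seq2)
qed simp

lemma runs_SeqI2:
  assumes "(step False)\<^sup>*\<^sup>* x Failed" "x = Run P G"
  shows "runs (Seq P Q) G Failed"
  using assms
proof (induction arbitrary: P G rule: converse_rtranclp_induct)
  case (step x y)
  then show ?case
    by (cases y) (auto intro: converse_rtranclp_into_rtranclp seq1 seq3)
qed simp

lemma runs_Seq:
  "final c \<Longrightarrow> runs (Seq P Q) G c \<longleftrightarrow>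
     c = Failed \<and> runs P G Failed \<or> (\<exists>H. runs P G (Done H) \<and> runs Q H c)"
  by (auto dest: runs_SeqD [OF _ refl] intro: runs_SeqI1 [OF _ refl, THEN rtranclp_trans]
      runs_SeqI2 [OF _ refl])

text \<open>A failing body makes the loop finish by \<open>loop2\<close>, and runs of the body stay
  hidden in the premises of single steps. So only the loop itself and final graphs are ever
  reached.\<close>

lemma not_runs_Loop_Failed: "\<not> runs (Loop P) G Failed"
proof -
  have "(\<exists>H. c = Run (Loop P) H) \<or> (\<exists>H. c = Done H)" if "runs (Loop P) G c" for c
    using that by (induction rule: rtranclp_induct) (auto elim: step_LoopE)
  then show ?thesis by blast
qed

fun wf_config :: "config \<Rightarrow> bool" where
  "wf_config (Run P G) \<longleftrightarrow> wf_prog P \<and> host_graph G"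
| "wf_config (Done H) \<longleftrightarrow> host_graph H"
| "wf_config Failed \<longleftrightarrow> True"

text \<open>Tailored to the induction rule of \<open>step\<close>: nested runs occur there as
  closures of the step relation conjoined with the induction hypothesis.\<close>

lemma tranclp_invariant:
  "(\<lambda>x y. r x y \<and> (I x \<longrightarrow> I y))\<^sup>+\<^sup>+ a b \<Longrightarrow> I a \<Longrightarrow> I b"
  by (induction rule: tranclp_induct) auto

lemma rtranclp_invariant:
  "(\<lambda>x y. r x y \<and> (I x \<longrightarrow> I y))\<^sup>*\<^sup>* a b \<Longrightarrow> I a \<Longrightarrow> I b"
  by (induction rule: rtranclp_induct) auto

lemma step_wf_config: "step b x y \<Longrightarrow> wf_config x \<longrightarrow> wf_config y"
  by (induction rule: step.induct)
    (auto dest: derives_host_graph tranclp_invariant [where I = wf_config]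
      rtranclp_invariant [where I = wf_config])

lemma runs_host_graph:
  assumes "runs P G (Done H)" "wf_prog P" "host_graph G"
  shows "host_graph H"
proof -
  have "wf_config (Done H)"
    using assms by (induction rule: rtranclp_induct) (auto dest: step_wf_config)
  then show ?thesis by simp
qed

text \<open>For an empty left-hand graph the morphism, injectivity and dangling requirements are
  vacuous. Only typing and the condition of the rule remain, so \<open>id\<close> serves as both
  maps.\<close>

lemma empty_lhs_derives:
  assumes "wf_rule r" "empty_lhs r" "cond_true r" "host_graph G"
  shows "\<exists>H. derives G r H"
proof -
  obtain \<alpha> where "well_typed \<alpha>" using well_typed_exists ..
  then have "is_match r G id id \<alpha>"
    using assms(2,3) by (simp add: is_match_def empty_lhs_def cond_true_def)
  then show ?thesis
    using result_exists [OF assms(1,4)] unfolding derives_def by blast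
qed

text \<open>Failure of the condition of a branching command merely selects a branch, so the
  condition may be arbitrary. Where a command starts from an intermediate graph, that graph must
  again be well formed for rules to be applicable.\<close>

lemma non_failing_not_Failed:
  "non_failing P \<Longrightarrow> wf_prog P \<Longrightarrow> host_graph G \<Longrightarrow> \<not> runs P G Failed"
proof (induction arbitrary: G rule: non_failing.induct)
  case 1
  then show ?case by (simp add: runs_Break)
next
  case 2
  let ?r = "\<lparr>lhs = empty_rgraph, rhs = empty_rgraph, iface = {}, rcond = None\<rparr>"
  have "\<exists>H. derives G ?r H"
    using 2 by (intro empty_lhs_derives)
      (auto simp: Skip_def empty_lhs_def empty_rgraph_def cond_true_def cond_holds_def)
  then show ?case by (simp add: Skip_def runs_Call_Failed)
next
  case (3 rs)
  then obtain r where "r \<in> set rs" "cond_true r" by blast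
  moreover from this 3 have "\<exists>H. derives G r H" by (intro empty_lhs_derives) auto
  ultimately show ?case by (auto simp: runs_Call_Failed)
next
  case (4 P)
  then show ?case by (simp add: not_runs_Loop_Failed)
next
  case (5 P Q)
  then show ?case by (auto simp: runs_Seq dest: runs_host_graph)
next
  case (6 P Q C)
  then show ?case by (auto simp: runs_If)
next
  case (7 P Q C)
  then show ?case by (auto simp: runs_Try dest: runs_host_graph)
qed

text \<open>The two claims need each other: failure of a sequence is a precondition of failure, and
  the precondition of a branching command refers to failure of its condition. The property must
  vary, since sequences feed one precondition into another.\<close>

lemma expressible_loop_free:
  assumes "loop_free P" "wf_prog P"
  shows "expressible (\<lambda>G. runs P G Failed)"
    and "expressible \<Phi> \<Longrightarrow> expressible (\<lambda>G. \<exists>H. runs P G (Done H) \<and> \<Phi> H)"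
  using assms
proof (induction P arbitrary: \<Phi>)
  case (Call rs)
  {
    case 1
    \<comment> \<open>Applicability is the precondition of the constant property true.\<close>
    have "expressible (\<lambda>G. \<not> (\<exists>r \<in> set rs. \<exists>H. derives G r H \<and> True))"
      using 1 by (intro expressible_not expressible_bex_list expressible_derives expressible_const) simp
    then show ?case by (simp add: runs_Call_Failed)
  next
    case 2
    have "expressible (\<lambda>G. \<exists>r \<in> set rs. \<exists>H. derives G r H \<and> \<Phi> H)"
      using 2 by (intro expressible_bex_list expressible_derives) simp_all
    then show ?case by (rule expressible_cong) (auto simp: runs_Call_Done)
  }
next
  case Break
  {
    case 1
    show ?case by (simp add: runs_Break expressible_const)
  next
    case 2
    then show ?case by (simp add: runs_Break)
  }
next
  case (Or P Q)
  {
    case 1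
    with Or.IH(1,3) show ?case by (simp add: runs_Or expressible_disj)
  next
    case 2
    with Or.IH(2,4) have "expressible (\<lambda>G. (\<exists>H. runs P G (Done H) \<and> \<Phi> H) \<or> (\<exists>H. runs Q G (Done H) \<and> \<Phi> H))"
      by (intro expressible_disj) simp_all
    then show ?case by (rule expressible_cong) (auto simp: runs_Or)
  }
next
  case (Seq P Q)
  {
    case 1
    with Seq.IH have "expressible (\<lambda>G. runs P G Failed \<or> (\<exists>H. runs P G (Done H) \<and> runs Q H Failed))"
      by (intro expressible_disj) simp_all
    then show ?case by (rule expressible_cong) (auto simp: runs_Seq)
  next
    case 2
    with Seq.IH have "expressible (\<lambda>G. \<exists>H. runs P G (Done H) \<and> (\<exists>H'. runs Q H (Done H') \<and> \<Phi> H'))"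
      by simp
    then show ?case by (rule expressible_cong) (auto simp: runs_Seq)
  }
next
  case (If C P Q)
  {
    case 1
    \<comment> \<open>The branches of \<open>if\<close> start from \<open>G\<close> again, so all
      that counts is whether the condition can terminate, which is its precondition of true.\<close>
    with If.IH have "expressible (\<lambda>G. (\<exists>H. runs C G (Done H) \<and> True) \<and> runs P G Failed \<or>
        runs C G Failed \<and> runs Q G Failed)"
      by (intro expressible_disj expressible_conj If.IH(2) expressible_const) simp_all
    then show ?case by (rule expressible_cong) (auto simp: runs_If)
  next
    case 2
    with If.IH have "expressible (\<lambda>G. (\<exists>H. runs C G (Done H) \<and> True) \<and> (\<exists>H. runs P G (Done H) \<and> \<Phi> H) \<or>
        runs C G Failed \<and> (\<exists>H. runs Q G (Done H) \<and> \<Phi> H))"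
      by (intro expressible_disj expressible_conj If.IH(2) expressible_const) simp_all
    then show ?case by (rule expressible_cong) (auto simp: runs_If)
  }
next
  case (Try C P Q)
  {
    case 1
    with Try.IH have "expressible (\<lambda>G. (\<exists>H. runs C G (Done H) \<and> runs P H Failed) \<or>
        runs C G Failed \<and> runs Q G Failed)"
      by (intro expressible_disj expressible_conj) simp_all
    then show ?case by (rule expressible_cong) (auto simp: runs_Try)
  next
    case 2
    with Try.IH have "expressible (\<lambda>G. (\<exists>H. runs C G (Done H) \<and> (\<exists>H'. runs P H (Done H') \<and> \<Phi> H')) \<or>
        runs C G Failed \<and> (\<exists>H. runs Q G (Done H) \<and> \<Phi> H))"
      by (intro expressible_disj expressible_conj) simp_all
    then show ?case by (rule expressible_cong) (auto simp: runs_Try)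
  }
qed simp_all

text \<open>Preconditions are taken along loop-free prefixes only. The property pulled back through
  \<open>C\<close> is failure of the remaining command, which the induction hypothesis
  expresses.\<close>

lemma expressible_iteration_command:
  "iteration_command S \<Longrightarrow> wf_prog S \<Longrightarrow> expressible (\<lambda>G. runs S G Failed)"
proof (induction rule: iteration_command.induct)
  case (1 P)
  then show ?case by (simp add: expressible_loop_free)
next
  case (2 P)
  then show ?case
    using expressible_cong [OF expressible_const [of False]] non_failing_not_Failed by metis
next
  case (3 C P)
  then have "expressible (\<lambda>G. runs C G Failed \<or> (\<exists>H. runs C G (Done H) \<and> runs P H Failed))"
    using expressible_loop_free [of C] by (intro expressible_disj) simp_all
  then show ?case by (rule expressible_cong) (auto simp: runs_Seq)
qed

theorem theorem3:
  fixes S :: prog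
  assumes "wf_prog S" and "iteration_command S"
  shows "\<exists>c. closed_form c \<and> (\<forall>G. host_graph G \<longrightarrow> (G \<Turnstile> c \<longleftrightarrow> Fail \<in> sem S G))"
proof -
  \<comment> \<open>\<open>Run S G\<close> differs from \<open>Failed\<close>, so reaching failure
    takes at least one step anyway.\<close>
  have "Fail \<in> sem S G \<longleftrightarrow> runs S G Failed" for G
    by (simp add: sem_def tranclp_Run_iff)
  then show ?thesis
    using expressible_iteration_command [OF assms(2,1)] by (simp add: expressible_def)
qed

end
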